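(* Let $\mathcal X:=(\mathbb C^\times)^2$ with coordinates $(u,v)$, set $m=4$ and $\zeta=e^{2\pi i/m}=i$, let $\mathcal H=\mathbb C^4$ with the Weyl operators $\mathbf X,\mathbf Z\in\mathrm{GL}(\mathcal H)$, and let $g_u,g_v\in\mathrm{PGL}(\mathcal H)$ be the projective monodromies around the $u$-loop and the $v$-loop. Identify $\mathcal H\cong\mathcal H_A\otimes\mathcal H_B$, $\mathcal H_A\cong\mathcal H_B\cong\mathbb C^2$, by $|a\rangle_A\otimes|b\rangle_B\leftrightarrow|a+2b\rangle$, $a,b\in\{0,1\}$. Then: (i) $g_u$ is local: in $\mathrm{PGL}(\mathcal H_A\otimes\mathcal H_B)$ one has $\mathbf Z\equiv S_A\otimes Z_B$, where $S_A=\mathrm{diag}(1,i)$ and $Z_B=\mathrm{diag}(1,-1)$. (ii) $g_v$ is entangling and CNOT-class: in $\mathrm{PGL}(\mathcal H_A\otimes\mathcal H_B)$, $$\mathbf X^{-1}\equiv\mathrm{CNOT}_{A,B}\,(X_A\otimes I_B)$$ (projective equality), hence $g_v$ is locally equivalent to $\mathrm{CNOT}$. (iii) Consequently, if one can implement a universal single-qubit gate set on each factor and the monodromy gate $g_v$, then these gates generate a dense subgroup of $\mathrm{PU}(\mathcal H_A\otimes\mathcal H_B)\cong\mathrm{PU}(4)$.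
   Context: Let $\{|r\rangle\}_{r\in\mathbb Z/4\mathbb Z}$ be the standard basis of $\mathcal H$. The Weyl operators are $\mathbf X|r\rangle=|r+1\rangle$ and $\mathbf Z|r\rangle=\zeta^r|r\rangle$, so $\mathbf Z\mathbf X=\zeta\mathbf X\mathbf Z$. On a simply connected open $U\subset\mathcal X$ with chosen branches of $u^{1/4},v^{1/4}$, the symbol algebra with generators $x,y$ and relations $x^4=u$, $y^4=v$, $yx=\zeta xy$ is represented on $\mathcal H$ by $x(u,v)=u^{1/4}\mathbf X$, $y(u,v)=v^{1/4}\mathbf Z$. For a base point $(u_0,v_0)\in U$, analytic continuation along $\gamma_u(t)=(u_0e^{2\pi it},v_0)$ multiplies $u^{1/4}$ (hence $x$) by $\zeta$, and along $\gamma_v(t)=(u_0,v_0e^{2\pi it})$ multiplies $v^{1/4}$ (hence $y$) by $\zeta$; these changes are absorbed by conjugation ($yxy^{-1}=\zeta x$, $x^{-1}yx=\zeta y$), and the corresponding projective monodromies are $g_u=[y(u_0,v_0)]=[\mathbf Z]$ and $g_v=[x(u_0,v_0)^{-1}]=[\mathbf X^{-1}]$ in $\mathrm{PGL}(\mathcal H)$. $X_A$ is the bit flip $|a\rangle\mapsto|a+1\bmod2\rangle$; $\mathrm{CNOT}_{A,B}|a,b\rangle=|a,\,b+a\bmod2\rangle$; $\equiv$ denotes equality up to a nonzero scalar. An element of $\mathrm{PGL}(\mathcal H_A\otimes\mathcal H_B)$ is local if it is the class of some $U_A\otimes U_B$, and entangling if it sends some product state (class of a nonzero pure tensor) to a non-product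 state. Two elements are locally equivalent if they differ by left and right multiplication by local (unitary) elements. A universal single-qubit gate set on a factor is a set of unitaries generating a dense subgroup of $\mathrm{PU}(2)$. *)

theory Defs
  imports "HOL-Analysis.Analysis" "HOL-Algebra.Generated_Groups"
begin

section \<open>Projective linear and projective unitary groups\<close>

definition GL :: "(complex^'n^'n) monoid" where
  "GL = \<lparr>carrier = {A. invertible A}, mult = (**), one = mat 1\<rparr>"

definition scalars :: "(complex^'n^'n) set" where
  "scalars = {mat c | c. c \<noteq> 0}"

definition PGL :: "(complex^'n^'n) set monoid" where
  "PGL = GL Mod scalars"

definition pclass :: "complex^'n^'n \<Rightarrow> (complex^'n^'n) set" where
  "pclass A = scalars #>\<^bsub>GL\<^esub> A"

definition proj_eq :: "complex^'n^'n \<Rightarrow> complex^'n^'n \<Rightarrow> bool" (infix "\<equiv>\<^sub>p" 50) where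
  "A \<equiv>\<^sub>p B \<longleftrightarrow> (\<exists>c. c \<noteq> 0 \<and> A = mat c ** B)"

definition adjoint_mat :: "complex^'n^'n \<Rightarrow> complex^'n^'n" where
  "adjoint_mat A = (\<chi> i j. cnj (A $ j $ i))"

definition unitary :: "(complex^'n^'n) set" where
  "unitary = {A. A ** adjoint_mat A = mat 1 \<and> adjoint_mat A ** A = mat 1}"

text \<open>
  The projective unitary group is realised as the subgroup of \<^const>\<open>PGL\<close> consisting of the
  classes of unitary matrices. It carries the quotient topology of the unitary group.
\<close>

definition PU :: "(complex^'n^'n) set monoid" where
  "PU = PGL\<lparr>carrier := pclass ` unitary\<rparr>"

definition quot_topology :: "'a topology \<Rightarrow> ('a \<Rightarrow> 'b) \<Rightarrow> 'b topology" where
  "quot_topology X f =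
     topology (\<lambda>V. V \<subseteq> f ` topspace X \<and> openin X {x \<in> topspace X. f x \<in> V})"

lemma openin_quot_topology:
  "openin (quot_topology X f) V \<longleftrightarrow>
     V \<subseteq> f ` topspace X \<and> openin X {x \<in> topspace X. f x \<in> V}"
proof -
  have "istopology (\<lambda>V. V \<subseteq> f ` topspace X \<and> openin X {x \<in> topspace X. f x \<in> V})"
    unfolding istopology_def
  proof (intro conjI allI impI)
    fix S T
    assume S: "S \<subseteq> f ` topspace X \<and> openin X {x \<in> topspace X. f x \<in> S}"
      and T: "T \<subseteq> f ` topspace X \<and> openin X {x \<in> topspace X. f x \<in> T}"
    show "S \<inter> T \<subseteq> f ` topspace X" using S by blast
    have "{x \<in> topspace X. f x \<in> S \<inter> T}
        = {x \<in> topspace X. f x \<in> S} \<inter> {x \<in> topspace X. f x \<in> T}" by blast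
    then show "openin X {x \<in> topspace X. f x \<in> S \<inter> T}" using S T by (simp add: openin_Int)
  next
    fix K
    assume K: "\<forall>S\<in>K. S \<subseteq> f ` topspace X \<and> openin X {x \<in> topspace X. f x \<in> S}"
    show "\<Union>K \<subseteq> f ` topspace X" using K by blast
    have "{x \<in> topspace X. f x \<in> \<Union>K} = (\<Union>S\<in>K. {x \<in> topspace X. f x \<in> S})" by blast
    then show "openin X {x \<in> topspace X. f x \<in> \<Union>K}" using K by auto
  qed
  then show ?thesis by (simp add: quot_topology_def topology_inverse')
qed

definition PU_top :: "(complex^'n^'n) set topology" where
  "PU_top = quot_topology (top_of_set unitary) pclass"

definition generates_dense :: "(complex^'n^'n) set set \<Rightarrow> bool" where
  "generates_dense S \<longleftrightarrow>
     S \<subseteq> carrier PU \<and> subgroup (generate PU S) PU \<and>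
     PU_top closure_of (generate PU S) = carrier PU"


section \<open>Weyl operators\<close>

text \<open>
  The index types \<^typ>\<open>2\<close> and \<^typ>\<open>4\<close> of \<^theory>\<open>HOL-Library.Numeral_Type\<close> are the rings of
  integers modulo 2 and modulo 4, so that index arithmetic is modular;
  \<^const>\<open>Rep_bit0\<close> yields the integer representative in \<open>{0..<2}\<close> and \<open>{0..<4}\<close>, respectively.
\<close>

definition ket :: "'n \<Rightarrow> complex^'n" where
  "ket r = axis r 1"

text \<open>The matrix of the linear map sending the basis vector \<open>ket j\<close> to \<open>f j\<close>.\<close>

definition op_on_kets :: "('n \<Rightarrow> complex^'n) \<Rightarrow> complex^'n^'n" where
  "op_on_kets f = (\<chi> i j. f j $ i)"

definition zeta :: complex where
  "zeta = exp (2 * of_real pi * \<i> / 4)"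

definition Weyl_X :: "complex^4^4" where
  "Weyl_X = op_on_kets (\<lambda>r. ket (r + 1))"

definition Weyl_Z :: "complex^4^4" where
  "Weyl_Z = op_on_kets (\<lambda>r. zeta powi Rep_bit0 r *s ket r)"


section \<open>Projective monodromy of the represented symbol algebra\<close>

definition torus2 :: "(complex \<times> complex) set" where
  "torus2 = (UNIV - {0}) \<times> (UNIV - {0})"

definition holomorphic2_on :: "(complex \<times> complex \<Rightarrow> complex) \<Rightarrow> (complex \<times> complex) set \<Rightarrow> bool" where
  "holomorphic2_on f D \<longleftrightarrow>
     (\<forall>p\<in>D. \<exists>a b. (f has_derivative (\<lambda>h. a * fst h + b * snd h)) (at p))"

text \<open>
  The germ of \<open>g\<close> at \<open>\<gamma> 1\<close> is obtained from the germ of \<open>f\<close> at \<open>\<gamma> 0\<close> by analytic continuation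
  along \<open>\<gamma>\<close>, through the function elements \<open>(F t, D t)\<close>.
\<close>

definition continues_along ::
  "(real \<Rightarrow> complex \<times> complex) \<Rightarrow> (complex \<times> complex \<Rightarrow> complex) \<Rightarrow>
   (complex \<times> complex \<Rightarrow> complex) \<Rightarrow> bool" where
  "continues_along \<gamma> f g \<longleftrightarrow>
     (\<exists>F D.
        (\<forall>t\<in>{0..1}. open (D t) \<and> \<gamma> t \<in> D t \<and> holomorphic2_on (F t) (D t)) \<and>
        (\<forall>t\<in>{0..1}. \<forall>\<^sub>F s in at t within {0..1}.
           \<gamma> s \<in> D t \<and> (\<forall>\<^sub>F p in nhds (\<gamma> s). F s p = F t p)) \<and>
        (\<forall>\<^sub>F p in nhds (\<gamma> 0). F 0 p = f p) \<and>
        (\<forall>\<^sub>F p in nhds (\<gamma> 1). F 1 p = g p))"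

text \<open>
  The images of the generators \<open>x\<close> and \<open>y\<close> of the symbol algebra at the point \<open>p = (u, v)\<close>, where
  \<open>r\<close> and \<open>s\<close> are the chosen branches of the fourth roots of \<open>u\<close> and \<open>v\<close>.
\<close>

definition rep_x :: "(complex \<times> complex \<Rightarrow> complex) \<Rightarrow> complex \<times> complex \<Rightarrow> complex^4^4" where
  "rep_x r p = mat (r p) ** Weyl_X"

definition rep_y :: "(complex \<times> complex \<Rightarrow> complex) \<Rightarrow> complex \<times> complex \<Rightarrow> complex^4^4" where
  "rep_y s p = mat (s p) ** Weyl_Z"

text \<open>
  The projective monodromy along a loop \<open>\<gamma>\<close> is the class of the operators \<open>A\<close> such that conjugation
  \<open>a \<mapsto> A a A\<^sup>-\<^sup>1\<close> turns the representation at the base point into its analytic continuation along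
  \<open>\<gamma>\<close>. (It is unique since the Weyl operators act irreducibly.)
\<close>

definition proj_monodromy ::
  "(complex \<times> complex \<Rightarrow> complex) \<Rightarrow> (complex \<times> complex \<Rightarrow> complex) \<Rightarrow>
   (real \<Rightarrow> complex \<times> complex) \<Rightarrow> (complex^4^4) set" where
  "proj_monodromy r s \<gamma> =
     (THE g. \<exists>A r' s'. invertible A \<and> g = pclass A \<and>
        continues_along \<gamma> r r' \<and> continues_along \<gamma> s s' \<and>
        A ** rep_x r (\<gamma> 0) ** matrix_inv A = rep_x r' (\<gamma> 1) \<and>
        A ** rep_y s (\<gamma> 0) ** matrix_inv A = rep_y s' (\<gamma> 1))"

definition loop_u :: "complex \<Rightarrow> complex \<Rightarrow> real \<Rightarrow> complex \<times> complex" where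
  "loop_u u0 v0 t = (u0 * exp (2 * of_real pi * \<i> * of_real t), v0)"

definition loop_v :: "complex \<Rightarrow> complex \<Rightarrow> real \<Rightarrow> complex \<times> complex" where
  "loop_v u0 v0 t = (u0, v0 * exp (2 * of_real pi * \<i> * of_real t))"


section \<open>Two qubits\<close>

text \<open>
  The space \<open>H\<^sub>A \<otimes> H\<^sub>B\<close> is \<^typ>\<open>complex^(2 \<times> 2)\<close>, whose basis vector \<open>ket (a, b)\<close> is
  \<open>ket a \<otimes> ket b\<close>.
\<close>

definition tensor_vec :: "complex^2 \<Rightarrow> complex^2 \<Rightarrow> complex^(2 \<times> 2)" (infixr "\<otimes>\<^sub>v" 70) where
  "v \<otimes>\<^sub>v w = (\<chi> p. v $ fst p * w $ snd p)"

definition tensor_op :: "complex^2^2 \<Rightarrow> complex^2^2 \<Rightarrow> complex^(2 \<times> 2)^(2 \<times> 2)" (infixr "\<otimes>\<^sub>o" 75) where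
  "A \<otimes>\<^sub>o B = (\<chi> p q. A $ fst p $ fst q * B $ snd p $ snd q)"

text \<open>
  The identification \<open>ket (a, b) \<leftrightarrow> ket (a + 2 b)\<close> with \<^typ>\<open>complex^4\<close>, and the induced
  transport of operators and of their projective classes from \<^typ>\<open>complex^4\<close> to \<open>H\<^sub>A \<otimes> H\<^sub>B\<close>.
\<close>

definition qubit_index :: "2 \<times> 2 \<Rightarrow> 4" where
  "qubit_index p = of_int (Rep_bit0 (fst p)) + 2 * of_int (Rep_bit0 (snd p))"

definition to_AB :: "complex^4^4 \<Rightarrow> complex^(2 \<times> 2)^(2 \<times> 2)" where
  "to_AB M = (\<chi> p q. M $ qubit_index p $ qubit_index q)"

definition PGL_to_AB :: "(complex^4^4) set \<Rightarrow> (complex^(2 \<times> 2)^(2 \<times> 2)) set" where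
  "PGL_to_AB g = to_AB ` g"

definition diag2 :: "complex \<Rightarrow> complex \<Rightarrow> complex^2^2" where
  "diag2 c d = op_on_kets (\<lambda>a. (if a = 0 then c else d) *s ket a)"

definition S_gate :: "complex^2^2" where
  "S_gate = diag2 1 \<i>"

definition Z_gate :: "complex^2^2" where
  "Z_gate = diag2 1 (-1)"

definition X_gate :: "complex^2^2" where
  "X_gate = op_on_kets (\<lambda>a. ket (a + 1))"

definition CNOT :: "complex^(2 \<times> 2)^(2 \<times> 2)" where
  "CNOT = op_on_kets (\<lambda>(a, b). ket (a, b + a))"

definition is_local :: "(complex^(2 \<times> 2)^(2 \<times> 2)) set \<Rightarrow> bool" where
  "is_local g \<longleftrightarrow> (\<exists>A B. invertible A \<and> invertible B \<and> g = pclass (A \<otimes>\<^sub>o B))"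

definition is_local_unitary :: "(complex^(2 \<times> 2)^(2 \<times> 2)) set \<Rightarrow> bool" where
  "is_local_unitary g \<longleftrightarrow> (\<exists>A\<in>unitary. \<exists>B\<in>unitary. g = pclass (A \<otimes>\<^sub>o B))"

definition locally_equivalent ::
  "(complex^(2 \<times> 2)^(2 \<times> 2)) set \<Rightarrow> (complex^(2 \<times> 2)^(2 \<times> 2)) set \<Rightarrow> bool" where
  "locally_equivalent g h \<longleftrightarrow>
     (\<exists>k l. is_local_unitary k \<and> is_local_unitary l \<and> g = k \<otimes>\<^bsub>PGL\<^esub> h \<otimes>\<^bsub>PGL\<^esub> l)"

definition state_class :: "complex^'n \<Rightarrow> (complex^'n) set" where
  "state_class v = {c *s v | c. c \<noteq> 0}"

definition proj_act :: "(complex^'n^'n) set \<Rightarrow> (complex^'n) set \<Rightarrow> (complex^'n) set" where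
  "proj_act g S = {M *v w | M w. M \<in> g \<and> w \<in> S}"

definition product_state :: "(complex^(2 \<times> 2)) set \<Rightarrow> bool" where
  "product_state S \<longleftrightarrow> (\<exists>v w. v \<noteq> 0 \<and> w \<noteq> 0 \<and> S = state_class (v \<otimes>\<^sub>v w))"

definition entangling :: "(complex^(2 \<times> 2)^(2 \<times> 2)) set \<Rightarrow> bool" where
  "entangling g \<longleftrightarrow> (\<exists>S. product_state S \<and> \<not> product_state (proj_act g S))"

definition universal_single_qubit :: "(complex^2^2) set \<Rightarrow> bool" where
  "universal_single_qubit G \<longleftrightarrow> G \<subseteq> unitary \<and> generates_dense (pclass ` G)"

end

theory Submission
  imports Defs "HOL-Complex_Analysis.Conformal_Mappings"
begin

text \<open>
  A continuation of a fourth root along the loop satisfies the same equation \<open>F\<^sup>4 = u\<close> (or \<open>v\<close>), so it is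
  multiplied by \<open>\<i>\<close> or by 1; since only scalars commute with both Weyl operators, the two monodromies
  are the classes of \<open>Z\<close> and \<open>X\<^sup>-\<^sup>1\<close>, and their two-qubit forms are read off from the basis.

  For density, the closure \<open>K\<close> of the unitary matrices whose class is generated contains all local
  unitaries, hence CNOT. Conjugating CNOT by local unitaries yields CZ, and from CZ the controlled
  Hermitian reflections with either control, since all of them are conjugate to \<open>Z\<close>. Products of two
  controlled reflections and a local phase give the diagonal phases, and permuting the basis by CNOT
  and \<open>X\<close> gives reflections in every coordinate plane. Column elimination by these reflections and
  phases reduces every unitary matrix to the identity, so \<open>K\<close> is the whole unitary group.
\<close>

section \<open>Matrices up to scalars\<close>

text \<open>Conjugation preserves spectra, so one controlled gate with eigenvalues 1 and -1 on its
  target yields, by local conjugation, only controlled gates with that spectrum. This is why the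
  elimination uses Hermitian reflections instead of rotations, and why diagonal phases need a
  separate product. Density is stated in a quotient, and universality of the local gates controls
  matrices only up to scalars. The passage to matrices works because the full preimage of a set of
  classes is stable under unit scalars and the quotient map is open. For the monodromies, the
  function elements of a continuation may have disconnected domains, so only germs along the path
  carry information. Uniqueness therefore propagates an equation between germs, and existence needs
  explicit elements whose germs agree for nearby parameters; this agreement comes from the
  separation of distinct fourth roots.\<close>

lemma mat_mult_nth [simp]:
  fixes A :: "complex^'n^'n"
  shows "(mat c ** A) $ i $ j = c * A $ i $ j"
  by (simp add: matrix_matrix_mult_def mat_def if_distrib if_distribR sum.delta' cong: if_cong)

lemma mult_mat_nth [simp]:
  fixes A :: "complex^'n^'n"
  shows "(A ** mat c) $ i $ j = c * A $ i $ j"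
  by (simp add: matrix_matrix_mult_def mat_def if_distrib if_distribR sum.delta' mult.commute cong: if_cong)

lemma mat_nth: "mat c $ i $ j = (if i = j then c else 0)"
  by (simp add: mat_def)

lemma mat_mult_mat: "mat c ** mat d = (mat (c * d) :: complex^'n^'n)"
  by (simp add: vec_eq_iff mat_nth)

lemma mult_mat_commute:
  fixes A :: "complex^'n^'n"
  shows "A ** mat c = mat c ** A"
  by (simp add: vec_eq_iff)

lemma mult_mat_left_commute:
  fixes A :: "complex^'n^'n"
  shows "A ** (mat c ** B) = mat c ** (A ** B)"
  by (metis matrix_mul_assoc mult_mat_commute)

lemma mat_mult_mult:
  fixes A :: "complex^'n^'n"
  shows "(mat c ** A) ** (mat d ** B) = mat (c * d) ** (A ** B)"
  by (metis matrix_mul_assoc mat_mult_mat mult_mat_commute)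

lemma matrix_inv_unique:
  fixes A :: "complex^'n^'n"
  assumes "A ** B = mat 1"
  shows "matrix_inv A = B"
proof -
  have BA: "B ** A = mat 1"
    using assms matrix_left_right_inverse by blast
  then have "invertible A"
    using assms by (auto simp: invertible_def)
  then have "A ** matrix_inv A = mat 1"
    unfolding matrix_inv_def invertible_def by (metis (mono_tags, lifting) someI_ex)
  then show ?thesis
    by (metis BA matrix_mul_assoc matrix_mul_lid matrix_mul_rid)
qed

section \<open>Adjoints and unitary matrices\<close>

lemma adjoint_mult: "adjoint_mat (A ** B) = adjoint_mat B ** adjoint_mat A"
  by (simp add: adjoint_mat_def matrix_matrix_mult_def vec_eq_iff mult.commute)

lemma adjoint_mat_mat: "adjoint_mat (mat c) = mat (cnj c)"
  by (auto simp: adjoint_mat_def vec_eq_iff mat_nth)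

lemma adjoint_adjoint [simp]: "adjoint_mat (adjoint_mat A) = A"
  by (simp add: adjoint_mat_def)

lemma unitary_iff: "A \<in> unitary \<longleftrightarrow> A ** adjoint_mat A = mat 1"
  by (auto simp: unitary_def matrix_left_right_inverse[of A])

lemma unitary_adjoint: "A \<in> unitary \<Longrightarrow> adjoint_mat A \<in> unitary"
  by (auto simp: unitary_def)

lemma unitary_mult: "A \<in> unitary \<Longrightarrow> B \<in> unitary \<Longrightarrow> A ** B \<in> unitary"
  unfolding unitary_iff adjoint_mult by (metis matrix_mul_assoc matrix_mul_lid)

lemma unitary_mat: "cmod c = 1 \<Longrightarrow> mat c \<in> unitary"
  by (simp add: unitary_iff adjoint_mat_mat mat_mult_mat complex_norm_square[symmetric])

lemma unitary_one [simp]: "mat 1 \<in> unitary"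
  by (simp add: unitary_mat)

lemma unitary_adjoint_cancel:
  assumes "A \<in> unitary"
  shows "A ** adjoint_mat A = mat 1" "adjoint_mat A ** A = mat 1"
    "A ** (adjoint_mat A ** B) = B" "adjoint_mat A ** (A ** B) = B"
    "(B ** A) ** adjoint_mat A = B" "(B ** adjoint_mat A) ** A = B"
  using assms by (auto simp: unitary_def matrix_mul_assoc)
    (auto simp flip: matrix_mul_assoc)

lemma unitary_invertible: "A \<in> unitary \<Longrightarrow> invertible A"
  by (auto simp: unitary_def invertible_def)

lemma norm_1_if_unitary_multiple:
  fixes A :: "complex^'n^'n"
  assumes "A \<in> unitary" "mat c ** A \<in> unitary"
  shows "cmod c = 1"
proof -
  have "mat 1 = (mat c ** A) ** adjoint_mat (mat c ** A)"
    using assms(2) by (simp add: unitary_iff)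
  also have "\<dots> = mat c ** (A ** adjoint_mat A) ** mat (cnj c)"
    by (simp add: adjoint_mult adjoint_mat_mat matrix_mul_assoc)
  also have "\<dots> = mat (c * cnj c)"
    using assms(1) by (simp add: unitary_iff mat_mult_mat)
  finally have "(mat 1 :: complex^'n^'n) $ i $ i = (mat (c * cnj c) :: complex^'n^'n) $ i $ i" for i
    by metis
  then have "complex_of_real ((cmod c)\<^sup>2) = 1"
    by (simp add: mat_nth complex_norm_square del: of_real_power)
  then have "(cmod c)\<^sup>2 = 1"
    using of_real_eq_1_iff by blast
  then show ?thesis
    by (simp add: power2_eq_1_iff) (use norm_ge_zero[of c] in linarith)
qed

section \<open>Projective classes and the group \<open>PU\<close>\<close>

lemma pclass_eq: "pclass A = {mat c ** A | c. c \<noteq> 0}"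
  by (auto simp: pclass_def r_coset_def scalars_def GL_def)

lemma pclass_eqI: "A \<equiv>\<^sub>p B \<Longrightarrow> pclass A = pclass B"
  unfolding proj_eq_def pclass_eq
proof safe
  fix c d :: complex
  assume "c \<noteq> 0" "d \<noteq> 0"
  show "\<exists>e. mat d ** (mat c ** B) = mat e ** B \<and> e \<noteq> 0"
    using \<open>c \<noteq> 0\<close> \<open>d \<noteq> 0\<close> by (intro exI[of _ "d * c"]) (simp add: matrix_mul_assoc mat_mult_mat)
  show "\<exists>e. mat d ** B = mat e ** (mat c ** B) \<and> e \<noteq> 0"
    using \<open>c \<noteq> 0\<close> \<open>d \<noteq> 0\<close> by (intro exI[of _ "d / c"]) (simp add: matrix_mul_assoc mat_mult_mat)
qed

lemma pclass_self: "A \<in> pclass A"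
  unfolding pclass_eq by (auto intro!: exI[of _ 1])

lemma pclass_eq_iff: "pclass A = pclass B \<longleftrightarrow> A \<equiv>\<^sub>p B"
proof
  assume "pclass A = pclass B"
  then have "A \<in> pclass B"
    using pclass_self by blast
  then show "A \<equiv>\<^sub>p B"
    by (auto simp: pclass_eq proj_eq_def)
qed (rule pclass_eqI)

lemma pclass_mat_mult [simp]: "c \<noteq> 0 \<Longrightarrow> pclass (mat c ** A) = pclass A"
  by (auto simp: pclass_eq_iff proj_eq_def)

lemma pclass_mult: "pclass A \<otimes>\<^bsub>PGL\<^esub> pclass B = pclass (A ** B)"
proof -
  have "pclass A \<otimes>\<^bsub>PGL\<^esub> pclass B = (\<Union>X\<in>pclass A. \<Union>Y\<in>pclass B. {X ** Y})"
    by (simp add: PGL_def FactGroup_def set_mult_def GL_def)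
  also have "\<dots> = pclass (A ** B)"
  proof (intro equalityI subsetI)
    fix M assume "M \<in> (\<Union>X\<in>pclass A. \<Union>Y\<in>pclass B. {X ** Y})"
    then show "M \<in> pclass (A ** B)"
      by (auto simp: pclass_eq mat_mult_mult)
  next
    fix M assume "M \<in> pclass (A ** B)"
    then obtain c where "c \<noteq> 0" "M = mat c ** (A ** B)"
      by (auto simp: pclass_eq)
    then have "M = (mat c ** A) ** B" "mat c ** A \<in> pclass A"
      by (auto simp: matrix_mul_assoc pclass_eq)
    then show "M \<in> (\<Union>X\<in>pclass A. \<Union>Y\<in>pclass B. {X ** Y})"
      using pclass_self by blast
  qed
  finally show ?thesis .
qed

lemma carrier_PU: "carrier PU = pclass ` unitary"
  by (simp add: PU_def)

lemma PU_mult: "pclass A \<otimes>\<^bsub>PU\<^esub> pclass B = pclass (A ** B)"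
  by (simp add: PU_def pclass_mult)

lemma PU_one: "\<one>\<^bsub>PU\<^esub> = pclass (mat 1)"
  by (simp add: PU_def PGL_def FactGroup_def pclass_eq scalars_def)

lemma group_PU: "group (PU :: (complex^'n^'n) set monoid)"
proof (rule groupI)
  fix x :: "(complex^'n^'n) set" assume "x \<in> carrier PU"
  then obtain A where A: "A \<in> unitary" "x = pclass A"
    by (auto simp: carrier_PU)
  then show "\<exists>y\<in>carrier PU. y \<otimes>\<^bsub>PU\<^esub> x = \<one>\<^bsub>PU\<^esub>"
    by (auto simp: carrier_PU PU_mult PU_one unitary_adjoint_cancel intro!: bexI[of _ "adjoint_mat A"] unitary_adjoint)
qed (auto simp: carrier_PU PU_mult PU_one unitary_mult matrix_mul_assoc)

lemma PU_inv:
  assumes "A \<in> unitary"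
  shows "inv\<^bsub>PU\<^esub> (pclass A) = pclass (adjoint_mat A)"
  using assms by (intro group.inv_equality group_PU)
    (auto simp: PU_mult PU_one carrier_PU unitary_adjoint unitary_adjoint_cancel)

text \<open>A class contains all nonzero multiples of a matrix, but its unitary members form a
  single orbit of the unit circle.\<close>

lemma pclass_eq_unitary_iff:
  assumes "A \<in> unitary"
  shows "B \<in> unitary \<and> pclass B = pclass A \<longleftrightarrow> (\<exists>c. cmod c = 1 \<and> B = mat c ** A)"
proof
  assume "B \<in> unitary \<and> pclass B = pclass A"
  then obtain c where "B = mat c ** A" "B \<in> unitary"
    by (auto simp: pclass_eq_iff proj_eq_def)
  then show "\<exists>c. cmod c = 1 \<and> B = mat c ** A"
    using norm_1_if_unitary_multiple[OF assms] by blast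
next
  assume "\<exists>c. cmod c = 1 \<and> B = mat c ** A"
  then obtain c where c: "cmod c = 1" "B = mat c ** A"
    by blast
  then have "c \<noteq> 0"
    by force
  then show "B \<in> unitary \<and> pclass B = pclass A"
    using c assms by (simp add: unitary_mult unitary_mat)
qed

section \<open>Density in the projective unitary group\<close>

lemma tendsto_matrix_mult:
  fixes f :: "'a \<Rightarrow> complex^'n^'m" and g :: "'a \<Rightarrow> complex^'k^'n"
  assumes "(f \<longlongrightarrow> A) F" "(g \<longlongrightarrow> B) F"
  shows "((\<lambda>x. f x ** g x) \<longlongrightarrow> A ** B) F"
  unfolding matrix_matrix_mult_def by (intro tendsto_intros assms)

lemma tendsto_adjoint:
  assumes "(f \<longlongrightarrow> A) F"
  shows "((\<lambda>x. adjoint_mat (f x)) \<longlongrightarrow> adjoint_mat A) F"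
  unfolding adjoint_mat_def by (intro tendsto_intros assms)

lemma closed_unitary: "closed unitary"
  unfolding closed_sequential_limits
proof safe
  fix f :: "nat \<Rightarrow> complex^'n^'n" and l
  assume f: "\<forall>n. f n \<in> unitary" "f \<longlonglongrightarrow> l"
  then have "(\<lambda>n. f n ** adjoint_mat (f n)) \<longlonglongrightarrow> l ** adjoint_mat l"
    by (intro tendsto_matrix_mult tendsto_adjoint)
  then have "(\<lambda>n. mat 1) \<longlonglongrightarrow> l ** adjoint_mat l"
    using f(1) by (simp add: unitary_iff)
  then show "l \<in> unitary"
    by (simp add: unitary_iff LIMSEQ_const_iff)
qed

text \<open>Inverses are written as adjoints because \<open>adjoint_mat\<close> is continuous on all
  matrices, so this condition survives limits.\<close>

definition unitary_subgroup :: "(complex^'n^'n) set \<Rightarrow> bool" where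
  "unitary_subgroup K \<longleftrightarrow> K \<subseteq> unitary \<and> mat 1 \<in> K \<and>
     (\<forall>A\<in>K. \<forall>B\<in>K. A ** B \<in> K) \<and> (\<forall>A\<in>K. adjoint_mat A \<in> K)"

lemma unitary_subgroup_closure:
  assumes "unitary_subgroup K"
  shows "unitary_subgroup (closure K)"
  unfolding unitary_subgroup_def
proof (intro conjI ballI)
  show "closure K \<subseteq> unitary"
    using assms closed_unitary by (intro closure_minimal) (auto simp: unitary_subgroup_def)
  show "mat 1 \<in> closure K"
    using assms closure_subset by (auto simp: unitary_subgroup_def)
  fix A assume "A \<in> closure K"
  then obtain f where f: "\<And>n. f n \<in> K" "f \<longlonglongrightarrow> A"
    by (auto simp: closure_sequential)
  have "(\<lambda>n. adjoint_mat (f n)) \<longlonglongrightarrow> adjoint_mat A"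
    by (intro tendsto_adjoint f)
  then show "adjoint_mat A \<in> closure K"
    using assms f(1) unfolding closure_sequential unitary_subgroup_def
    by (intro exI[of _ "\<lambda>n. adjoint_mat (f n)"]) simp
  fix B assume "B \<in> closure K"
  then obtain g where g: "\<And>n. g n \<in> K" "g \<longlonglongrightarrow> B"
    by (auto simp: closure_sequential)
  have "(\<lambda>n. f n ** g n) \<longlonglongrightarrow> A ** B"
    by (intro tendsto_matrix_mult f g)
  then show "A ** B \<in> closure K"
    using assms f(1) g(1) unfolding closure_sequential unitary_subgroup_def
    by (intro exI[of _ "\<lambda>n. f n ** g n"]) simp
qed

lemma unitary_subgroup_preimage:
  assumes "subgroup H PU"
  shows "unitary_subgroup {A \<in> unitary. pclass A \<in> H}"
proof -
  have "pclass (mat 1) \<in> H"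
    using subgroup.one_closed[OF assms] by (simp add: PU_one)
  moreover have "pclass (A ** B) \<in> H" if "pclass A \<in> H" "pclass B \<in> H" for A B
    using subgroup.m_closed[OF assms that] by (simp add: PU_mult)
  moreover have "pclass (adjoint_mat A) \<in> H" if "pclass A \<in> H" "A \<in> unitary" for A
    using subgroup.m_inv_closed[OF assms that(1)] that(2) by (simp add: PU_inv)
  ultimately show ?thesis
    by (auto simp: unitary_subgroup_def unitary_mult unitary_adjoint)
qed

section \<open>The quotient topology on projective classes\<close>

lemma topspace_quot_topology: "topspace (quot_topology X f) = f ` topspace X"
proof (rule equalityI)
  show "topspace (quot_topology X f) \<subseteq> f ` topspace X"
    using openin_topspace[of "quot_topology X f"] unfolding openin_quot_topology by blast
  have "{x \<in> topspace X. f x \<in> f ` topspace X} = topspace X"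
    by blast
  then have "openin (quot_topology X f) (f ` topspace X)"
    unfolding openin_quot_topology by auto
  then show "f ` topspace X \<subseteq> topspace (quot_topology X f)"
    by (rule openin_subset)
qed

lemma topspace_PU_top: "topspace PU_top = carrier PU"
  by (simp add: PU_top_def topspace_quot_topology carrier_PU)

lemma openin_PU_top_iff:
  "openin PU_top V \<longleftrightarrow> V \<subseteq> carrier PU \<and> openin (top_of_set unitary) {A \<in> unitary. pclass A \<in> V}"
  by (simp add: PU_top_def openin_quot_topology carrier_PU)

text \<open>The quotient map is open: its fibres are circle orbits, so the saturation of
  \<open>W\<close> is a union of preimages of \<open>W\<close> under multiplication by unit
  scalars.\<close>

lemma openin_PU_top_image:
  fixes W :: "(complex^'n^'n) set"
  assumes "open W"
  shows "openin PU_top (pclass ` (unitary \<inter> W))"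
proof -
  have cont: "continuous_on UNIV (\<lambda>A. mat c ** A)" for c :: complex
    unfolding continuous_on_def by (intro ballI tendsto_matrix_mult tendsto_intros)
  have "open (\<Union>c\<in>{c. cmod c = 1}. (\<lambda>A. mat c ** A) -` W)"
    using assms cont by (intro open_UN ballI open_vimage)
  moreover have "{A \<in> unitary. pclass A \<in> pclass ` (unitary \<inter> W)} =
      unitary \<inter> (\<Union>c\<in>{c. cmod c = 1}. (\<lambda>A. mat c ** A) -` W)" (is "?L = ?R")
  proof (intro equalityI subsetI)
    fix A assume "A \<in> ?L"
    then obtain B where B: "A \<in> unitary" "B \<in> unitary" "B \<in> W" "pclass B = pclass A"
      by auto
    then obtain c where "cmod c = 1" "B = mat c ** A"
      using pclass_eq_unitary_iff by blast
    with B show "A \<in> ?R"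
      by auto
  next
    fix A assume "A \<in> ?R"
    then obtain c where "A \<in> unitary" "cmod c = 1" "mat c ** A \<in> W"
      by auto
    moreover from this have "mat c ** A \<in> unitary \<and> pclass (mat c ** A) = pclass A"
      using pclass_eq_unitary_iff by blast
    ultimately show "A \<in> ?L"
      by (metis (mono_tags, lifting) IntI imageI mem_Collect_eq)
  qed
  ultimately show ?thesis
    by (auto simp: openin_PU_top_iff carrier_PU openin_open_Int)
qed

text \<open>Trades the quotient topology for limits of matrices. From left to right the quotient map
  has to be open; the converse rests on its continuity.\<close>

lemma generates_dense_iff:
  fixes S :: "(complex^'n^'n) set set"
  assumes "S \<subseteq> carrier PU"
  shows "generates_dense S \<longleftrightarrow> unitary \<subseteq> closure {A \<in> unitary. pclass A \<in> generate PU S}"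
    (is "_ \<longleftrightarrow> _ \<subseteq> closure ?L")
proof -
  let ?H = "generate PU S"
  have H: "subgroup ?H PU"
    by (rule group.generate_is_subgroup[OF group_PU assms])
  have "PU_top closure_of ?H = carrier PU \<longleftrightarrow> unitary \<subseteq> closure ?L"
  proof
    assume dense: "PU_top closure_of ?H = carrier PU"
    show "unitary \<subseteq> closure ?L"
    proof
      fix A :: "complex^'n^'n" assume A: "A \<in> unitary"
      have "?L \<inter> W \<noteq> {}" if W: "open W" "A \<in> W" for W
      proof -
        have "pclass A \<in> PU_top closure_of ?H"
          using A dense by (simp add: carrier_PU)
        moreover have "pclass A \<in> pclass ` (unitary \<inter> W)"
          using A W by blast
        ultimately have "\<exists>y. y \<in> ?H \<and> y \<in> pclass ` (unitary \<inter> W)"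
          using openin_PU_top_image[OF W(1)] by (simp add: in_closure_of)
        then show ?thesis
          by auto
      qed
      then show "A \<in> closure ?L"
        unfolding closure_iff_nhds_not_empty by blast
    qed
  next
    assume dense: "unitary \<subseteq> closure ?L"
    have "x \<in> PU_top closure_of ?H" if x: "x \<in> carrier PU" for x
      unfolding in_closure_of topspace_PU_top
    proof (intro conjI allI impI x)
      fix T assume T: "x \<in> T \<and> openin PU_top T"
      obtain A where A: "A \<in> unitary" "x = pclass A"
        using x by (auto simp: carrier_PU)
      obtain W where W: "open W" "{A \<in> unitary. pclass A \<in> T} = unitary \<inter> W"
        using T by (auto simp: openin_PU_top_iff openin_open)
      have "A \<in> W"
        using W A T by blast
      then have "?L \<inter> W \<noteq> {}"
        using dense A(1) open_Int_closure_eq_empty[OF W(1), of ?L] by blast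
      then obtain B where "B \<in> unitary" "pclass B \<in> ?H" "B \<in> W"
        by blast
      then show "\<exists>y. y \<in> ?H \<and> y \<in> T"
        using W(2) by blast
    qed
    then show "PU_top closure_of ?H = carrier PU"
      using closure_of_subset_topspace[of PU_top ?H] unfolding topspace_PU_top by blast
  qed
  then show ?thesis
    using H assms by (simp add: generates_dense_def)
qed

section \<open>Two-level reflections and phases generate the unitary group\<close>

text \<open>For distinct \<open>p\<close> and \<open>q\<close> these are the two-level matrices of
  quantum compiling, the complex counterpart of Givens rotations.\<close>

definition two_level :: "'n \<Rightarrow> 'n \<Rightarrow> complex \<Rightarrow> complex \<Rightarrow> complex \<Rightarrow> complex \<Rightarrow> complex^'n^'n" where
  "two_level p q a b c d = (\<chi> i j.
     if i = p then (if j = p then a else if j = q then b else 0)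
     else if i = q then (if j = p then c else if j = q then d else 0)
     else if i = j then 1 else 0)"

definition phase :: "'n \<Rightarrow> complex \<Rightarrow> complex^'n^'n" where
  "phase q z = (\<chi> i j. if i = j then (if i = q then z else 1) else 0)"

lemma phase_mult: "(phase q z *v x) $ i = (if i = q then z else 1) * x $ i"
proof -
  have "(phase q z *v x) $ i = (\<Sum>j\<in>UNIV. if i = j then (if i = q then z else 1) * x $ i else 0)"
    unfolding phase_def matrix_vector_mult_def vec_lambda_beta by (intro sum.cong) auto
  then show ?thesis
    by simp
qed

lemma two_level_mult:
  assumes "p \<noteq> q"
  shows "(two_level p q a b c d *v x) $ i =
    (if i = p then a * x $ p + b * x $ q else if i = q then c * x $ p + d * x $ q else x $ i)"
proof -
  have "(\<Sum>j\<in>UNIV. (if j = p then y * x $ p else if j = q then z * x $ q else 0)) = y * x $ p + z * x $ q"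
    for y z :: complex
  proof -
    have "(\<Sum>j\<in>UNIV. (if j = p then y * x $ p else if j = q then z * x $ q else 0)) =
        (\<Sum>j\<in>UNIV. (if j = p then y * x $ p else 0) + (if j = q then z * x $ q else 0))"
      using assms by (intro sum.cong) auto
    then show ?thesis
      by (simp add: sum.distrib)
  qed
  moreover have "(two_level p q a b c d *v x) $ i =
    (\<Sum>j\<in>UNIV. (if i = p then (if j = p then a * x $ p else if j = q then b * x $ q else 0)
     else if i = q then (if j = p then c * x $ p else if j = q then d * x $ q else 0)
     else if i = j then x $ i else 0))"
    unfolding two_level_def matrix_vector_mult_def vec_lambda_beta
    by (intro sum.cong) (use assms in auto)
  ultimately show ?thesis
    by simp
qed

lemma norm_vec_square: "(norm x)\<^sup>2 = (\<Sum>i\<in>UNIV. (cmod (x $ i))\<^sup>2)"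
  for x :: "complex^'n"
  by (simp add: norm_vec_def L2_set_def sum_nonneg)

lemma mult_axis_nth [simp]:
  fixes A :: "complex^'n^'m"
  shows "(A *v axis q 1) $ i = A $ i $ q"
  by (simp add: matrix_vector_mult_def axis_def if_distrib cong: if_cong)

lemma mat_eqI_axis:
  fixes A :: "complex^'n^'m"
  assumes "\<And>q. A *v axis q 1 = B *v axis q 1"
  shows "A = B"
  using assms by (simp add: vec_eq_iff)

lemma unitary_norm:
  assumes "A \<in> unitary"
  shows "norm (A *v x) = norm x"
proof -
  have inner: "complex_of_real ((norm y)\<^sup>2) = (\<Sum>i\<in>UNIV. y $ i * cnj (y $ i))" for y :: "complex^'a"
    by (simp add: norm_vec_square complex_norm_square del: of_real_power)
  have "(\<Sum>i\<in>UNIV. (A *v x) $ i * cnj ((A *v x) $ i)) = (\<Sum>i\<in>UNIV. \<Sum>j\<in>UNIV. \<Sum>k\<in>UNIV. A $ i $ j * x $ j * (cnj (A $ i $ k) * cnj (x $ k)))"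
    by (simp add: matrix_vector_mult_def sum_product)
  also have "\<dots> = (\<Sum>j\<in>UNIV. \<Sum>k\<in>UNIV. \<Sum>i\<in>UNIV. A $ i $ j * x $ j * (cnj (A $ i $ k) * cnj (x $ k)))"
    by (subst sum.swap) (intro sum.cong refl sum.swap)
  also have "\<dots> = (\<Sum>j\<in>UNIV. \<Sum>k\<in>UNIV. (adjoint_mat A ** A) $ k $ j * (x $ j * cnj (x $ k)))"
    by (simp add: adjoint_mat_def matrix_matrix_mult_def sum_distrib_left mult_ac)
  also have "\<dots> = (\<Sum>j\<in>UNIV. x $ j * cnj (x $ j))"
    using assms by (simp add: unitary_def mat_nth if_distrib if_distribR cong: if_cong)
  finally have "complex_of_real ((norm (A *v x))\<^sup>2) = of_real ((norm x)\<^sup>2)"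
    unfolding inner .
  then have "(norm (A *v x))\<^sup>2 = (norm x)\<^sup>2"
    using of_real_eq_iff by blast
  then show ?thesis
    by simp
qed

text \<open>
  The matrix with rows \<open>(c, s)\<close> and \<open>(cnj s, - c)\<close> is a Hermitian unitary that maps \<open>(a, b)\<close> to a
  multiple of the first basis vector.
\<close>

lemma two_level_annihilate:
  fixes a b :: complex
  obtains c :: real and s where "0 \<le> c" "c\<^sup>2 + (cmod s)\<^sup>2 = 1" "cnj s * a - of_real c * b = 0"
proof (cases "a = 0")
  case True
  then show ?thesis
    using that[of 0 1] by simp
next
  case False
  define n where "n = sqrt ((cmod a)\<^sup>2 + (cmod b)\<^sup>2)"
  have n: "n > 0" "n\<^sup>2 = (cmod a)\<^sup>2 + (cmod b)\<^sup>2"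
    using False by (auto simp: n_def add_pos_nonneg)
  show ?thesis
  \<comment> \<open>Taking \<open>c\<close> proportional to \<open>cmod a\<close> keeps it
    nonnegative; the linear equation then determines \<open>s\<close>, and \<open>n\<close>
    normalises the pair.\<close>
  proof (rule that[of "cmod a / n" "cnj b * a / (cmod a * n)"])
    show "0 \<le> cmod a / n"
      using n by simp
    have "cmod (cnj b * a / (cmod a * n)) = cmod b / n"
      using False n by (simp add: norm_mult norm_divide)
    then show "(cmod a / n)\<^sup>2 + (cmod (cnj b * a / (cmod a * n)))\<^sup>2 = 1"
      using n False by (simp add: power_divide add_divide_distrib[symmetric])
    have "cnj a * a = complex_of_real (cmod a) * of_real (cmod a)"
      by (metis complex_norm_square mult.commute power2_eq_square of_real_power)
    then show "cnj (cnj b * a / (cmod a * n)) * a - complex_of_real (cmod a / n) * b = 0"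
      using False n by (simp add: field_simps)
  qed
qed

text \<open>Reflections are required only for \<open>0 \<le> c\<close>: these are the ones that
  \<open>two_level_annihilate\<close> produces and that conjugates of \<open>Z_gate\<close> supply
  later.\<close>

locale two_level_universal =
  fixes K :: "(complex^'n^'n) set"
  assumes subgroup: "unitary_subgroup K"
    and phase_in: "\<And>q z. cmod z = 1 \<Longrightarrow> phase q z \<in> K"
    and reflection_in: "\<And>p q c s. p \<noteq> q \<Longrightarrow> 0 \<le> c \<Longrightarrow> c\<^sup>2 + (cmod s)\<^sup>2 = 1 \<Longrightarrow>
      two_level p q (of_real c) s (cnj s) (- of_real c) \<in> K"
begin

lemma mult_in: "A \<in> K \<Longrightarrow> B \<in> K \<Longrightarrow> A ** B \<in> K"
  and one_in: "mat 1 \<in> K"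
  and adjoint_in: "A \<in> K \<Longrightarrow> adjoint_mat A \<in> K"
  and in_unitary: "A \<in> K \<Longrightarrow> A \<in> unitary"
  using subgroup by (auto simp: unitary_subgroup_def)

text \<open>Induction on the support of \<open>x\<close> besides \<open>q\<close>: each reflection
  clears one entry and moves its weight into entry \<open>q\<close>. Finally entry \<open>q\<close>
  has modulus 1 and a phase turns it into 1. The clause on the other basis vectors protects columns
  that are already reduced.\<close>

lemma rotate_to_axis:
  assumes "finite T" "q \<notin> T" "norm x = 1" "\<And>i. i \<notin> insert q T \<Longrightarrow> x $ i = 0"
  shows "\<exists>V\<in>K. (\<forall>i. i \<notin> insert q T \<longrightarrow> V *v axis i 1 = axis i 1) \<and> V *v x = axis q 1"
  using assms
proof (induction T arbitrary: x rule: finite_induct)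
  case empty
  have "(norm x)\<^sup>2 = (\<Sum>i\<in>UNIV. if i = q then (cmod (x $ q))\<^sup>2 else 0)"
    unfolding norm_vec_square by (intro sum.cong refl) (simp add: empty)
  then have "cmod (x $ q) = 1"
    using empty by (simp add: power2_eq_1_iff) (use norm_ge_zero[of "x $ q"] in linarith)
  then have q: "cnj (x $ q) * x $ q = 1"
    by (metis complex_norm_square mult.commute of_real_1 power_one)
  show ?case
  proof (intro bexI[of _ "phase q (cnj (x $ q))"] conjI allI impI)
    show "phase q (cnj (x $ q)) *v x = axis q 1"
      using q by (subst vec_eq_iff) (auto simp: phase_mult axis_def empty)
  qed (auto simp: vec_eq_iff phase_mult axis_def phase_in \<open>cmod (x $ q) = 1\<close>)
next
  case (insert p T)
  have pq: "p \<noteq> q"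
    using insert by auto
  obtain c s where cs: "0 \<le> c" "c\<^sup>2 + (cmod s)\<^sup>2 = 1" "cnj s * x $ q - of_real c * x $ p = 0"
    by (rule two_level_annihilate)
  define G where "G = two_level q p (of_real c) s (cnj s) (- of_real c)"
  have G: "G \<in> K"
    unfolding G_def using cs pq by (intro reflection_in) auto
  have G_nth: "(G *v y) $ i = (if i = q then c * y $ q + s * y $ p
      else if i = p then cnj s * y $ q - c * y $ p else y $ i)" for y i
    using pq by (simp add: G_def two_level_mult)
  have "norm (G *v x) = 1"
    using G insert by (simp add: unitary_norm in_unitary)
  moreover have "(G *v x) $ i = 0" if "i \<notin> insert q T" for i
    using that cs(3) insert.prems(3) by (auto simp: G_nth)
  ultimately obtain V where V: "V \<in> K" "\<forall>i. i \<notin> insert q T \<longrightarrow> V *v axis i 1 = axis i 1"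
    "V *v (G *v x) = axis q 1"
    using insert.IH[of "G *v x"] insert.prems(1) by auto
  have "G *v axis i 1 = axis i 1" if "i \<notin> insert q (insert p T)" for i
    using that by (auto simp: vec_eq_iff G_nth axis_def)
  then show ?case
    using V G by (intro bexI[of _ "V ** G"]) (auto simp: mult_in simp flip: matrix_vector_mul_assoc)
qed

text \<open>\<open>S\<close> holds the columns still to be reduced. Reducing column \<open>q\<close>
  leaves the finished ones alone, so the induction ends at the identity, and \<open>S = UNIV\<close>
  covers every unitary matrix.\<close>

lemma fixing_outside_in:
  assumes "finite S" "U \<in> unitary" "\<And>i. i \<notin> S \<Longrightarrow> U *v axis i 1 = axis i 1"
  shows "U \<in> K"
  using assms
proof (induction S arbitrary: U rule: finite_induct)
  case empty
  have "U = mat 1"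
    using empty by (intro mat_eqI_axis) simp
  then show ?case
    by (simp add: one_in)
next
  case (insert q S)
  define x where "x = U *v axis q 1"
  \<comment> \<open>If a unitary matrix fixes a basis vector, so does its adjoint; hence row
    \<open>i\<close> of \<open>U\<close> vanishes off the diagonal.\<close>
  have "x $ i = 0" if "i \<notin> insert q S" for i
  proof -
    have "adjoint_mat U *v axis i 1 = adjoint_mat U *v (U *v axis i 1)"
      using insert.prems(2)[OF that] by simp
    also have "\<dots> = axis i 1"
      using insert.prems(1) by (simp add: matrix_vector_mul_assoc unitary_def)
    finally have "(adjoint_mat U *v axis i 1) $ q = 0"
      using that by (auto simp: axis_def)
    then show ?thesis
      by (simp add: x_def adjoint_mat_def)
  qed
  moreover have "norm x = 1"
    using insert.prems(1) by (simp add: x_def unitary_norm)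
  ultimately obtain V where V: "V \<in> K" "\<forall>i. i \<notin> insert q S \<longrightarrow> V *v axis i 1 = axis i 1" "V *v x = axis q 1"
    using rotate_to_axis[OF insert.hyps] by blast
  have "V ** U \<in> K"
  proof (rule insert.IH)
    show "V ** U \<in> unitary"
      using V insert.prems(1) by (simp add: unitary_mult in_unitary)
    show "(V ** U) *v axis i 1 = axis i 1" if "i \<notin> S" for i
      using that V insert.prems(2)[of i] by (cases "i = q") (auto simp: x_def simp flip: matrix_vector_mul_assoc)
  qed
  then have "adjoint_mat V ** (V ** U) \<in> K"
    using V by (simp add: mult_in adjoint_in)
  then show ?case
    using V by (simp add: unitary_adjoint_cancel in_unitary)
qed

lemma eq_unitary: "K = unitary"
proof
  show "unitary \<subseteq> K"
    using fixing_outside_in[of UNIV] by auto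
qed (use in_unitary in blast)

end

section \<open>Two-qubit gates\<close>

text \<open>\<open>exhaust_2\<close> and \<open>sum_2\<close> enumerate this type as 1 and 2;
  rewriting 2 to 0 restores bit notation.\<close>

lemma two_eq_0 [simp]: "(2 :: 2) = 0"
  by simp

lemma bit_cases: "(a :: 2) = 0 \<or> a = 1"
  using exhaust_2[of a] by auto

lemma all_bit: "(\<forall>a::2. P a) \<longleftrightarrow> P 0 \<and> P 1"
  using bit_cases by metis

lemma sum_bit: "(\<Sum>a\<in>(UNIV :: 2 set). f a) = f 0 + f 1"
  by (simp add: sum_2 add.commute)

lemma sum_qubits: "(\<Sum>p\<in>(UNIV :: (2 \<times> 2) set). f p) = f (0, 0) + f (0, 1) + f (1, 0) + f (1, 1)"
  by (simp add: UNIV_Times_UNIV[symmetric] sum.cartesian_product' sum_bit add.assoc del: UNIV_Times_UNIV)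

lemma tensor_op_nth [simp]: "(A \<otimes>\<^sub>o B) $ p $ q = A $ fst p $ fst q * B $ snd p $ snd q"
  by (simp add: tensor_op_def)

lemma tensor_op_mult: "(A \<otimes>\<^sub>o B) ** (C \<otimes>\<^sub>o D) = (A ** C) \<otimes>\<^sub>o (B ** D)"
  by (simp add: vec_eq_iff matrix_matrix_mult_def sum_qubits sum_bit algebra_simps)

lemma tensor_op_adjoint: "adjoint_mat (A \<otimes>\<^sub>o B) = adjoint_mat A \<otimes>\<^sub>o adjoint_mat B"
  by (simp add: vec_eq_iff adjoint_mat_def)

lemma tensor_op_one [simp]: "mat 1 \<otimes>\<^sub>o mat 1 = mat 1"
  by (auto simp: vec_eq_iff mat_nth)

lemma tensor_op_scale:
  "(mat c ** A) \<otimes>\<^sub>o B = mat c ** (A \<otimes>\<^sub>o B)" "A \<otimes>\<^sub>o (mat c ** B) = mat c ** (A \<otimes>\<^sub>o B)"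
  by (simp_all add: vec_eq_iff mult_ac)

lemma tensor_op_unitary: "A \<in> unitary \<Longrightarrow> B \<in> unitary \<Longrightarrow> A \<otimes>\<^sub>o B \<in> unitary"
  by (simp add: unitary_iff tensor_op_adjoint tensor_op_mult)

definition mat22 :: "complex \<Rightarrow> complex \<Rightarrow> complex \<Rightarrow> complex \<Rightarrow> complex^2^2" where
  "mat22 a b c d = (\<chi> i j. if i = 0 then (if j = 0 then a else b) else (if j = 0 then c else d))"

lemma diag2_mat22: "diag2 c d = mat22 c 0 0 d"
  by (simp add: vec_eq_iff all_bit diag2_def op_on_kets_def ket_def mat22_def axis_def)

lemma X_gate_mat22: "X_gate = mat22 0 1 1 0"
  by (simp add: vec_eq_iff all_bit X_gate_def op_on_kets_def ket_def mat22_def axis_def)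

lemma mat22_mult: "mat22 a b c d ** mat22 a' b' c' d' =
    mat22 (a * a' + b * c') (a * b' + b * d') (c * a' + d * c') (c * b' + d * d')"
  by (simp add: vec_eq_iff all_bit mat22_def matrix_matrix_mult_def sum_bit)

lemma mat22_adjoint: "adjoint_mat (mat22 a b c d) = mat22 (cnj a) (cnj c) (cnj b) (cnj d)"
  by (simp add: vec_eq_iff all_bit mat22_def adjoint_mat_def)

lemma mat22_one: "mat22 1 0 0 1 = mat 1"
  by (simp add: vec_eq_iff all_bit mat22_def mat_nth)

lemma diag2_unitary: "cmod c = 1 \<Longrightarrow> cmod d = 1 \<Longrightarrow> diag2 c d \<in> unitary"
  by (simp add: unitary_iff diag2_mat22 mat22_adjoint mat22_mult complex_norm_square[symmetric] flip: mat22_one)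

lemma X_gate_unitary: "X_gate \<in> unitary"
  by (simp add: unitary_iff X_gate_mat22 mat22_adjoint mat22_mult mat22_one)

definition reflection22 :: "real \<Rightarrow> complex \<Rightarrow> complex^2^2" where
  "reflection22 c s = mat22 (of_real c) s (cnj s) (- of_real c)"

text \<open>The columns of \<open>W\<close> are normalised eigenvectors; \<open>c \<ge> 0\<close> keeps \<open>(1 + c, cnj s)\<close> away from 0.\<close>

lemma reflection22_conj_Z:
  assumes "0 \<le> c" "c\<^sup>2 + (cmod s)\<^sup>2 = 1"
  obtains W where "W \<in> unitary" "W ** Z_gate ** adjoint_mat W = reflection22 c s"
proof -
  \<comment> \<open>The vector \<open>(1 + c, cnj s)\<close> has squared norm
    \<open>(1 + c)\<^sup>2 + 1 - c\<^sup>2 = 2 + 2 * c\<close>.\<close>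
  define t where "t = 1 / sqrt (2 + 2 * c)"
  have "t * t * (2 + 2 * c) = 1"
    using assms(1) by (simp add: t_def)
  then have t: "complex_of_real t * of_real t * (2 + 2 * of_real c) = 1"
    by (metis of_real_1 of_real_add of_real_mult of_real_numeral)
  have "complex_of_real (c\<^sup>2) + s * cnj s = 1"
    by (metis assms(2) complex_norm_square of_real_1 of_real_add)
  then have s: "s * cnj s = (1 - of_real c) * (1 + of_real c)"
    by (simp add: algebra_simps power2_eq_square)
  \<comment> \<open>With \<open>T\<close> and \<open>C\<close> as atoms fixed by conjugation, what
    remains are ring identities modulo the two relations named \<open>T\<close> and
    \<open>S\<close>.\<close>
  define T :: complex where "T = of_real t"
  define C :: complex where "C = of_real c"
  have T: "T * T * (2 + 2 * C) = 1" and S: "s * cnj s = (1 - C) * (1 + C)"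
    and cnjs: "cnj T = T" "cnj C = C"
    using t s by (simp_all add: T_def C_def)
  define W where "W = mat22 (T * (1 + C)) (- T * s) (T * cnj s) (T * (1 + C))"
  show ?thesis
  proof (rule that[of W])
    \<comment> \<open>\<open>e1\<close> says that the columns of \<open>W\<close> have norm 1;
      \<open>e2\<close> and \<open>e3\<close> give the diagonal and off-diagonal entries of the
      conjugated \<open>Z_gate\<close>.\<close>
    have e1: "T * (1 + C) * (T * (1 + C)) + T * s * (T * cnj s) = 1"
    proof -
      have "T * (1 + C) * (T * (1 + C)) + T * s * (T * cnj s) = T * T * ((1 + C) * (1 + C) + s * cnj s)"
        by (simp add: algebra_simps)
      also have "\<dots> = T * T * (2 + 2 * C)"
        unfolding S by (simp add: algebra_simps)
      finally show ?thesis
        using T by simp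
    qed
    have e2: "T * (1 + C) * (T * (1 + C)) - T * s * (T * cnj s) = C"
    proof -
      have "T * (1 + C) * (T * (1 + C)) - T * s * (T * cnj s) = T * T * ((1 + C) * (1 + C) - s * cnj s)"
        by (simp add: algebra_simps)
      also have "\<dots> = T * T * (2 + 2 * C) * C"
        unfolding S by (simp add: algebra_simps)
      finally show ?thesis
        using T by simp
    qed
    have e3: "T * (1 + C) * (T * z) + T * z * (T * (1 + C)) = z" for z
    proof -
      have "T * (1 + C) * (T * z) + T * z * (T * (1 + C)) = T * T * (2 + 2 * C) * z"
        by (simp add: algebra_simps)
      then show ?thesis
        using T by simp
    qed
    show "W \<in> unitary"
      using e1 by (simp add: unitary_iff W_def mat22_adjoint mat22_mult cnjs ac_simps flip: mat22_one)
    have "W ** Z_gate ** adjoint_mat W =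
        mat22 (T * (1 + C) * (T * (1 + C)) - T * s * (T * cnj s)) (T * (1 + C) * (T * s) + T * s * (T * (1 + C)))
          (T * (1 + C) * (T * cnj s) + T * cnj s * (T * (1 + C)))
          (- (T * (1 + C) * (T * (1 + C)) - T * s * (T * cnj s)))"
      by (simp add: W_def Z_gate_def diag2_mat22 mat22_adjoint mat22_mult cnjs) (simp add: algebra_simps)
    then show "W ** Z_gate ** adjoint_mat W = reflection22 c s"
      unfolding e2 e3 unfolding reflection22_def C_def .
  qed
qed

section \<open>Controlled gates\<close>

lemma matrix_add_mult_distrib: "(A + B) ** C = A ** C + B ** (C :: complex^'n^'m)"
  by (simp add: vec_eq_iff matrix_matrix_mult_def distrib_right sum.distrib)

text \<open>A sum over the two projectors of the control qubit, so that conjugating the target qubit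
  by a unitary changes only \<open>V\<close>.\<close>

definition ctrl_A :: "complex^2^2 \<Rightarrow> complex^(2 \<times> 2)^(2 \<times> 2)" where
  "ctrl_A V = diag2 1 0 \<otimes>\<^sub>o mat 1 + diag2 0 1 \<otimes>\<^sub>o V"

definition ctrl_B :: "complex^2^2 \<Rightarrow> complex^(2 \<times> 2)^(2 \<times> 2)" where
  "ctrl_B V = mat 1 \<otimes>\<^sub>o diag2 1 0 + V \<otimes>\<^sub>o diag2 0 1"

lemma ctrl_A_conj:
  "W \<in> unitary \<Longrightarrow> (mat 1 \<otimes>\<^sub>o W) ** ctrl_A V ** (mat 1 \<otimes>\<^sub>o adjoint_mat W) = ctrl_A (W ** V ** adjoint_mat W)"
  by (simp add: ctrl_A_def matrix_add_ldistrib matrix_add_mult_distrib tensor_op_mult unitary_iff)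

lemma ctrl_B_conj:
  "W \<in> unitary \<Longrightarrow> (W \<otimes>\<^sub>o mat 1) ** ctrl_B V ** (adjoint_mat W \<otimes>\<^sub>o mat 1) = ctrl_B (W ** V ** adjoint_mat W)"
  by (simp add: ctrl_B_def matrix_add_ldistrib matrix_add_mult_distrib tensor_op_mult unitary_iff)

lemma ctrl_A_two_level: "ctrl_A (mat22 a b c d) = two_level (1, 0) (1, 1) a b c d"
  by (simp add: vec_eq_iff all_bit ctrl_A_def two_level_def diag2_mat22 mat22_def mat_nth)

lemma ctrl_B_two_level: "ctrl_B (mat22 a b c d) = two_level (0, 1) (1, 1) a b c d"
  by (simp add: vec_eq_iff all_bit ctrl_B_def two_level_def diag2_mat22 mat22_def mat_nth)

text \<open>Both are diagonal with the single entry -1 at \<open>(1, 1)\<close>, a condition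
  symmetric in the qubits. This is the bridge from control \<open>A\<close> to control
  \<open>B\<close>.\<close>

lemma ctrl_Z_symmetric: "ctrl_A Z_gate = ctrl_B Z_gate"
  by (simp add: vec_eq_iff all_bit ctrl_A_def ctrl_B_def Z_gate_def diag2_mat22 mat22_def mat_nth)

section \<open>Permutations of the basis\<close>

definition perm_mat :: "('n \<Rightarrow> 'n) \<Rightarrow> complex^'n^'n" where
  "perm_mat f = (\<chi> i j. if i = f j then 1 else 0)"

text \<open>For an involution the permutation matrix is its own inverse, so the product is a
  conjugation and merely relabels the indices.\<close>

lemma perm_mat_conj:
  fixes M :: "complex^'n^'n"
  assumes "\<And>i. f (f i) = i"
  shows "perm_mat f ** M ** perm_mat f = (\<chi> i j. M $ f i $ f j)"
proof -
  have f: "i = f j \<longleftrightarrow> j = f i" for i j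
    using assms by metis
  have "(perm_mat f ** M) $ i $ j = (\<Sum>k\<in>UNIV. if k = f i then M $ f i $ j else 0)" for i j
    unfolding perm_mat_def matrix_matrix_mult_def vec_lambda_beta f[of i] by (intro sum.cong) auto
  then have left: "(perm_mat f ** M) $ i $ j = M $ f i $ j" for i j
    by simp
  have "(N ** perm_mat f) $ i $ j = (\<Sum>k\<in>UNIV. if k = f j then N $ i $ f j else 0)"
    for N :: "complex^'n^'n" and i j
    unfolding perm_mat_def matrix_matrix_mult_def vec_lambda_beta by (intro sum.cong) auto
  then have "(N ** perm_mat f) $ i $ j = N $ i $ f j" for N :: "complex^'n^'n" and i j
    by simp
  with left show ?thesis
    by (simp add: vec_eq_iff)
qed

lemma perm_mat_two_level:
  assumes "\<And>i. f (f i) = i"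
  shows "perm_mat f ** two_level p q a b c d ** perm_mat f = two_level (f p) (f q) a b c d"
proof -
  have "f i = j \<longleftrightarrow> i = f j" for i j
    using assms by metis
  moreover have "f i = f j \<longleftrightarrow> i = j" for i j
    using assms by metis
  ultimately show ?thesis
    unfolding perm_mat_conj[OF assms] by (simp add: vec_eq_iff two_level_def)
qed

lemma perm_mat_phase:
  assumes "\<And>i. f (f i) = i"
  shows "perm_mat f ** phase q z ** perm_mat f = phase (f q) z"
proof -
  have "f i = j \<longleftrightarrow> i = f j" for i j
    using assms by metis
  moreover have "f i = f j \<longleftrightarrow> i = j" for i j
    using assms by metis
  ultimately show ?thesis
    unfolding perm_mat_conj[OF assms] by (simp add: vec_eq_iff phase_def)
qed

lemma CNOT_perm: "CNOT = perm_mat (\<lambda>(a, b). (a, b + a))"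
  by (simp add: vec_eq_iff CNOT_def op_on_kets_def perm_mat_def ket_def axis_def split: prod.split)

lemma X_A_perm: "X_gate \<otimes>\<^sub>o mat 1 = perm_mat (\<lambda>(a, b). (a + 1, b))"
  by (simp add: vec_eq_iff X_gate_def op_on_kets_def perm_mat_def ket_def axis_def mat_nth split: prod.split)

lemma X_B_perm: "mat 1 \<otimes>\<^sub>o X_gate = perm_mat (\<lambda>(a, b). (a, b + 1))"
  by (simp add: vec_eq_iff X_gate_def op_on_kets_def perm_mat_def ket_def axis_def mat_nth split: prod.split)

lemma CNOT_ctrl: "CNOT = ctrl_A X_gate"
  by (simp add: vec_eq_iff all_bit X_gate_mat22 ctrl_A_two_level two_level_def CNOT_perm perm_mat_def)

lemma CNOT_unitary: "CNOT \<in> unitary"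
  by (simp add: unitary_iff vec_eq_iff all_bit CNOT_perm perm_mat_def matrix_matrix_mult_def adjoint_mat_def sum_qubits mat_nth)

section \<open>Unitary groups containing all local unitaries and \<open>CNOT\<close>\<close>

locale cnot_and_local =
  fixes K :: "(complex^(2 \<times> 2)^(2 \<times> 2)) set"
  assumes subgroup: "unitary_subgroup K"
    and tensor_A: "\<And>A. A \<in> unitary \<Longrightarrow> A \<otimes>\<^sub>o mat 1 \<in> K"
    and tensor_B: "\<And>B. B \<in> unitary \<Longrightarrow> mat 1 \<otimes>\<^sub>o B \<in> K"
    and CNOT_in: "CNOT \<in> K"
begin

lemma mult_in: "A \<in> K \<Longrightarrow> B \<in> K \<Longrightarrow> A ** B \<in> K"
  using subgroup by (auto simp: unitary_subgroup_def)

lemma ctrl_A_conj_in: "ctrl_A V \<in> K \<Longrightarrow> W \<in> unitary \<Longrightarrow> ctrl_A (W ** V ** adjoint_mat W) \<in> K"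
  by (metis ctrl_A_conj mult_in tensor_B unitary_adjoint)

lemma ctrl_B_conj_in: "ctrl_B V \<in> K \<Longrightarrow> W \<in> unitary \<Longrightarrow> ctrl_B (W ** V ** adjoint_mat W) \<in> K"
  by (metis ctrl_B_conj mult_in tensor_A unitary_adjoint)

text \<open>\<open>X_gate\<close> is the reflection with parameters 0 and 1, hence a conjugate of
  \<open>Z_gate\<close>; undoing this conjugation on the target turns \<open>CNOT\<close> into
  controlled \<open>Z_gate\<close>.\<close>

lemma ctrl_A_Z_in: "ctrl_A Z_gate \<in> K"
proof -
  obtain W where W: "W \<in> unitary" "W ** Z_gate ** adjoint_mat W = reflection22 0 1"
    by (rule reflection22_conj_Z[of 0 1]) auto
  have "W ** Z_gate ** adjoint_mat W = X_gate"
    by (simp add: W(2) reflection22_def X_gate_mat22)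
  then have "adjoint_mat W ** X_gate ** adjoint_mat (adjoint_mat W) = Z_gate"
    using W(1) by (metis adjoint_adjoint matrix_mul_assoc unitary_adjoint_cancel(4,6))
  then show ?thesis
    using ctrl_A_conj_in[of X_gate "adjoint_mat W"] CNOT_in W(1) by (simp add: CNOT_ctrl unitary_adjoint)
qed

lemma ctrl_reflection_in:
  assumes "0 \<le> c" "c\<^sup>2 + (cmod s)\<^sup>2 = 1"
  shows "ctrl_A (reflection22 c s) \<in> K" "ctrl_B (reflection22 c s) \<in> K"
  using reflection22_conj_Z[OF assms] ctrl_A_conj_in ctrl_B_conj_in ctrl_A_Z_in ctrl_Z_symmetric by metis+

lemma bit_add_add [simp]: "(a :: 2) + b + b = a"
  using bit_cases[of b] by (auto simp: add.assoc)

definition basis_perms :: "(2 \<times> 2 \<Rightarrow> 2 \<times> 2) set" where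
  "basis_perms = {\<lambda>(a, b). (a, b + a), \<lambda>(a, b). (a + 1, b), \<lambda>(a, b). (a, b + 1)}"

lemma basis_perms_involution: "f \<in> basis_perms \<Longrightarrow> f (f p) = p"
  by (cases p) (auto simp: basis_perms_def)

lemma basis_perms_in:
  assumes "f \<in> basis_perms"
  shows "perm_mat f \<in> K"
  using assms CNOT_in tensor_A[OF X_gate_unitary] tensor_B[OF X_gate_unitary]
  unfolding basis_perms_def CNOT_perm X_A_perm X_B_perm by auto

lemma two_level_perm_in:
  "f \<in> basis_perms \<Longrightarrow> two_level p q a b c d \<in> K \<Longrightarrow> two_level (f p) (f q) a b c d \<in> K"
  using perm_mat_two_level[of f] basis_perms_involution basis_perms_in mult_in by metis

lemma phase_perm_in: "f \<in> basis_perms \<Longrightarrow> phase q z \<in> K \<Longrightarrow> phase (f q) z \<in> K"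
  using perm_mat_phase[of f] basis_perms_involution basis_perms_in mult_in by metis

text \<open>The controlled gates act in planes whose two labels differ in one bit.
  \<open>CNOT\<close> fixes \<open>(0, 1)\<close> and sends \<open>(1, 1)\<close> to
  \<open>(1, 0)\<close>, which yields a plane whose labels differ in both bits.\<close>

lemma two_level_reflection_in:
  assumes "p \<noteq> q" and cs: "0 \<le> c" "c\<^sup>2 + (cmod s)\<^sup>2 = 1"
  shows "two_level p q (of_real c) s (cnj s) (- of_real c) \<in> K"
proof -
  define R where "R p q \<longleftrightarrow> two_level p q (of_real c) s (cnj s) (- of_real c) \<in> K" for p q
  have CNOT: "R (a, b) (a', b') \<Longrightarrow> R (a, b + a) (a', b' + a')"
    and XA: "R (a, b) (a', b') \<Longrightarrow> R (a + 1, b) (a' + 1, b')"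
    and XB: "R (a, b) (a', b') \<Longrightarrow> R (a, b + 1) (a', b' + 1)" for a b a' b'
    using two_level_perm_in[of "\<lambda>(a, b). (a, b + a)" "(a, b)" "(a', b')"]
      two_level_perm_in[of "\<lambda>(a, b). (a + 1, b)" "(a, b)" "(a', b')"]
      two_level_perm_in[of "\<lambda>(a, b). (a, b + 1)" "(a, b)" "(a', b')"]
    by (simp_all add: R_def basis_perms_def)
  have A: "R (1, 0) (1, 1)" and B: "R (0, 1) (1, 1)"
    using ctrl_reflection_in[OF cs] by (simp_all add: R_def reflection22_def ctrl_A_two_level ctrl_B_two_level)
  have C: "R (0, 1) (1, 0)"
    using CNOT[OF B] by simp
  \<comment> \<open>The seeds \<open>A\<close>, \<open>B\<close>, \<open>C\<close> realise the three
    nonzero differences of labels; the four translations by bit flips then reach each of the twelve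
    ordered pairs once.\<close>
  have "R (a, b) (a', b')" if "(a, b) \<noteq> (a', b')" for a b a' b'
    using that A B C XA[OF A] XB[OF A] XB[OF XA[OF A]] XA[OF B] XB[OF B] XB[OF XA[OF B]]
      XA[OF C] XB[OF C] XB[OF XA[OF C]] bit_cases[of a] bit_cases[of b] bit_cases[of a'] bit_cases[of b']
    by auto
  with \<open>p \<noteq> q\<close> show ?thesis
    unfolding R_def by (cases p, cases q) auto
qed

lemma phase_gate_in:
  assumes "cmod z = 1"
  shows "phase q z \<in> K"
proof -
  \<comment> \<open>The reflection with parameters 0 and \<open>cnj a\<close>, followed on the right
    by \<open>X_gate\<close>, is the diagonal matrix of \<open>cnj a\<close> and \<open>a\<close>.
    The phase \<open>a\<close> on the control qubit turns its controlled version into the phases 1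
    and \<open>a * a\<close>, so \<open>a\<close> must be a square root of \<open>z\<close>.\<close>
  define a where "a = csqrt z"
  have a: "a * a = z" "cmod a = 1" "a * cnj a = 1"
    using assms by (simp_all add: a_def power2_eq_square[symmetric] norm_csqrt complex_norm_square[symmetric])
  have "(diag2 1 a \<otimes>\<^sub>o mat 1) ** (ctrl_A (reflection22 0 (cnj a)) ** CNOT) = phase (1, 1) z"
    unfolding reflection22_def ctrl_A_two_level
    using a by (simp add: vec_eq_iff all_bit CNOT_perm perm_mat_def two_level_def phase_def diag2_mat22 mat22_def matrix_matrix_mult_def sum_qubits mat_nth)
  moreover have "\<dots> \<in> K"
    using a calculation[symmetric] CNOT_in ctrl_reflection_in(1)[of 0 "cnj a"] tensor_A[OF diag2_unitary[of 1 a]]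
    by (simp add: mult_in)
  ultimately have p11: "phase (1, 1) z \<in> K"
    by simp
  have p01: "phase (0, 1) z \<in> K"
    using phase_perm_in[OF _ p11, of "\<lambda>(a, b). (a + 1, b)"] by (simp add: basis_perms_def)
  have pb: "phase (a, 0) z \<in> K" if "phase (a, 1) z \<in> K" for a
    using phase_perm_in[OF _ that, of "\<lambda>(a, b). (a, b + 1)"] by (simp add: basis_perms_def)
  show ?thesis
    using p11 p01 pb[OF p11] pb[OF p01] bit_cases[of "fst q"] bit_cases[of "snd q"]
    by (cases q) auto
qed

lemma eq_unitary: "K = unitary"
  by (rule two_level_universal.eq_unitary, unfold_locales)
    (use subgroup two_level_reflection_in phase_gate_in in auto)

end

section \<open>Density of the group generated by local gates and CNOT\<close>

text \<open>To be used with tensoring by the identity on either side. The induction finds for each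
  generated class only some representative with image in \<open>H\<close>; the approximating matrix
  \<open>f n\<close> differs from it by a scalar, which \<phi> pulls out and \<open>pclass\<close>
  ignores.\<close>

lemma dense_image_in_closure:
  fixes \<phi> :: "complex^'m^'m \<Rightarrow> complex^'n^'n"
  assumes G: "G \<subseteq> unitary" "generates_dense (pclass ` G)" and H: "subgroup H PU"
    and GH: "\<And>A. A \<in> G \<Longrightarrow> pclass (\<phi> A) \<in> H"
    and mult: "\<And>A B. \<phi> (A ** B) = \<phi> A ** \<phi> B" and adj: "\<And>A. \<phi> (adjoint_mat A) = adjoint_mat (\<phi> A)"
    and one: "\<phi> (mat 1) = mat 1" and scale: "\<And>c A. \<phi> (mat c ** A) = mat c ** \<phi> A"
    and lim: "\<And>f A. f \<longlonglongrightarrow> A \<Longrightarrow> (\<lambda>n. \<phi> (f n)) \<longlonglongrightarrow> \<phi> A"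
    and A: "A \<in> unitary"
  shows "\<phi> A \<in> closure {B \<in> unitary. pclass B \<in> H}"
proof -
  have uni: "\<phi> B \<in> unitary" if "B \<in> unitary" for B
    using that by (simp add: unitary_iff one flip: mult adj)
  have generated: "\<exists>B\<in>unitary. g = pclass B \<and> pclass (\<phi> B) \<in> H" if "g \<in> generate PU (pclass ` G)" for g
    using that
  proof (induction rule: generate.induct)
    case one
    show ?case
      using subgroup.one_closed[OF H] by (intro bexI[of _ "mat 1"]) (auto simp: PU_one \<open>\<phi> (mat 1) = mat 1\<close>)
  next
    case (incl g)
    then show ?case
      using G(1) GH by auto
  next
    case (inv g)
    then obtain B where B: "B \<in> unitary" "g = pclass B" "pclass (\<phi> B) \<in> H"
      using G(1) GH by auto
    then have "pclass (\<phi> (adjoint_mat B)) \<in> H"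
      using subgroup.m_inv_closed[OF H B(3)] by (simp add: PU_inv uni adj)
    then show ?case
      using B by (intro bexI[of _ "adjoint_mat B"]) (auto simp: PU_inv unitary_adjoint)
  next
    case (eng g h)
    then obtain B C where "B \<in> unitary" "g = pclass B" "pclass (\<phi> B) \<in> H"
      and "C \<in> unitary" "h = pclass C" "pclass (\<phi> C) \<in> H"
      by blast
    then show ?case
      using subgroup.m_closed[OF H, of "pclass (\<phi> B)" "pclass (\<phi> C)"]
      by (intro bexI[of _ "B ** C"]) (auto simp: PU_mult mult unitary_mult)
  qed
  have "pclass ` G \<subseteq> carrier PU"
    using G(1) by (auto simp: carrier_PU)
  then have "A \<in> closure {B \<in> unitary. pclass B \<in> generate PU (pclass ` G)}"
    using G(2) A generates_dense_iff by blast
  then obtain f where f: "\<And>n. f n \<in> unitary" "\<And>n. pclass (f n) \<in> generate PU (pclass ` G)" "f \<longlonglongrightarrow> A"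
    unfolding closure_sequential by auto
  have "pclass (\<phi> (f n)) \<in> H" for n
  proof -
    obtain B where B: "pclass (f n) = pclass B" "pclass (\<phi> B) \<in> H"
      using generated[OF f(2)] by blast
    then obtain c where "c \<noteq> 0" "f n = mat c ** B"
      by (auto simp: pclass_eq_iff proj_eq_def)
    then show ?thesis
      using B(2) by (simp add: scale)
  qed
  then show ?thesis
    using f(1) uni lim[OF f(3)] unfolding closure_sequential
    by (intro exI[of _ "\<lambda>n. \<phi> (f n)"]) auto
qed

lemma tendsto_tensor_op:
  assumes "(f \<longlongrightarrow> A) F" "(g \<longlongrightarrow> B) F"
  shows "((\<lambda>x. f x \<otimes>\<^sub>o g x) \<longlongrightarrow> A \<otimes>\<^sub>o B) F"
  unfolding tensor_op_def by (intro tendsto_intros assms)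

lemma universal_with_CNOT:
  assumes A: "universal_single_qubit G_A" and B: "universal_single_qubit G_B"
  shows "generates_dense
    ({pclass (A \<otimes>\<^sub>o mat 1) | A. A \<in> G_A} \<union> {pclass (mat 1 \<otimes>\<^sub>o B) | B. B \<in> G_B} \<union>
     {pclass (CNOT ** (X_gate \<otimes>\<^sub>o mat 1))})"
    (is "generates_dense ?S")
proof -
  let ?H = "generate PU ?S"
  define L where "L = {A \<in> unitary. pclass A \<in> ?H}"
  have XU: "X_gate \<otimes>\<^sub>o mat 1 \<in> unitary"
    by (simp add: tensor_op_unitary X_gate_unitary)
  have S: "?S \<subseteq> carrier PU"
    using A B XU CNOT_unitary
    by (auto simp: carrier_PU universal_single_qubit_def tensor_op_unitary subset_iff unitary_mult)
  then have H: "subgroup ?H PU"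
    by (rule group.generate_is_subgroup[OF group_PU])
  have K: "unitary_subgroup (closure L)"
    unfolding L_def by (intro unitary_subgroup_closure unitary_subgroup_preimage H)
  have tA: "U \<otimes>\<^sub>o mat 1 \<in> closure L" if "U \<in> unitary" for U
    unfolding L_def
  proof (rule dense_image_in_closure[where \<phi> = "\<lambda>U. U \<otimes>\<^sub>o mat 1", OF _ _ H _ _ _ _ _ _ that])
    show "pclass (U \<otimes>\<^sub>o mat 1) \<in> ?H" if "U \<in> G_A" for U
      using that by (intro generate.incl) blast
    show "adjoint_mat U \<otimes>\<^sub>o mat 1 = adjoint_mat (U \<otimes>\<^sub>o mat 1)" for U
      by (simp add: tensor_op_adjoint adjoint_mat_mat)
  qed (use A in \<open>auto simp: universal_single_qubit_def tensor_op_mult tensor_op_scale intro: tendsto_tensor_op\<close>)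
  have tB: "mat 1 \<otimes>\<^sub>o U \<in> closure L" if "U \<in> unitary" for U
    unfolding L_def
  proof (rule dense_image_in_closure[where \<phi> = "\<lambda>U. mat 1 \<otimes>\<^sub>o U", OF _ _ H _ _ _ _ _ _ that])
    show "pclass (mat 1 \<otimes>\<^sub>o U) \<in> ?H" if "U \<in> G_B" for U
      using that by (intro generate.incl) blast
    show "mat 1 \<otimes>\<^sub>o adjoint_mat U = adjoint_mat (mat 1 \<otimes>\<^sub>o U)" for U
      by (simp add: tensor_op_adjoint adjoint_mat_mat)
  qed (use B in \<open>auto simp: universal_single_qubit_def tensor_op_mult tensor_op_scale intro: tendsto_tensor_op\<close>)
  \<comment> \<open>The bit flip is known to lie only in the closure of \<open>L\<close>, so the
    cancellation that isolates \<open>CNOT\<close> takes place there.\<close>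
  have "CNOT ** (X_gate \<otimes>\<^sub>o mat 1) \<in> L"
    unfolding L_def using XU CNOT_unitary by (auto simp: unitary_mult intro: generate.incl)
  then have "CNOT ** (X_gate \<otimes>\<^sub>o mat 1) \<in> closure L"
    using closure_subset by blast
  moreover have "adjoint_mat (X_gate \<otimes>\<^sub>o mat 1) \<in> closure L"
    using K tA[OF X_gate_unitary] by (simp add: unitary_subgroup_def)
  ultimately have "CNOT ** (X_gate \<otimes>\<^sub>o mat 1) ** adjoint_mat (X_gate \<otimes>\<^sub>o mat 1) \<in> closure L"
    using K unfolding unitary_subgroup_def by blast
  then have CNOT: "CNOT \<in> closure L"
    using unitary_adjoint_cancel(5)[OF XU] by simp
  interpret cnot_and_local "closure L"
    by unfold_locales (use K tA tB CNOT in auto)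
  show ?thesis
    unfolding generates_dense_iff[OF S] using eq_unitary by (simp add: L_def)
qed

section \<open>Identification of \<open>\<complex>\<^sup>4\<close> with two qubits\<close>

lemma all_4: "(\<forall>i::4. P i) \<longleftrightarrow> P 0 \<and> P 1 \<and> P 2 \<and> P 3"
proof -
  have four: "(4 :: 4) = 0"
    by simp
  show ?thesis
    unfolding forall_4 four by auto
qed

lemma qubit_index_simps [simp]:
  "qubit_index (0, 0) = 0" "qubit_index (1, 0) = 1" "qubit_index (0, 1) = 2" "qubit_index (1, 1) = 3"
  by (simp_all add: qubit_index_def bit0.Rep_0 bit0.Rep_1)

lemma bij_qubit_index: "bij qubit_index"
proof -
  have "inj qubit_index"
    unfolding inj_def by (simp add: all_bit)
  moreover have "\<forall>i. \<exists>p. qubit_index p = i"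
    unfolding all_4 using qubit_index_simps by blast
  ultimately show ?thesis
    by (simp add: bij_def surj_def) metis
qed

lemma to_AB_nth [simp]: "to_AB M $ p $ q = M $ qubit_index p $ qubit_index q"
  by (simp add: to_AB_def)

definition from_AB :: "complex^(2 \<times> 2)^(2 \<times> 2) \<Rightarrow> complex^4^4" where
  "from_AB N = (\<chi> i j. N $ inv_into UNIV qubit_index i $ inv_into UNIV qubit_index j)"

lemma to_AB_from_AB [simp]: "to_AB (from_AB N) = N"
  by (simp add: vec_eq_iff from_AB_def bij_is_inj[OF bij_qubit_index])

lemma from_AB_to_AB [simp]: "from_AB (to_AB M) = M"
  by (simp add: vec_eq_iff from_AB_def surj_f_inv_f[OF bij_is_surj[OF bij_qubit_index]])

lemma to_AB_mult: "to_AB (M ** N) = to_AB M ** to_AB N"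
  by (simp add: vec_eq_iff matrix_matrix_mult_def sum.reindex_bij_betw[OF bij_qubit_index, where g = "\<lambda>k. M $ i $ k * N $ k $ j" for i j])

lemma to_AB_mat: "to_AB (mat c) = mat c"
  by (auto simp: vec_eq_iff mat_nth inj_eq[OF bij_is_inj[OF bij_qubit_index]])

lemma to_AB_adjoint: "to_AB (adjoint_mat M) = adjoint_mat (to_AB M)"
  by (simp add: vec_eq_iff adjoint_mat_def)

lemma to_AB_unitary: "M \<in> unitary \<Longrightarrow> to_AB M \<in> unitary"
  by (simp add: unitary_iff to_AB_mat flip: to_AB_adjoint to_AB_mult)

lemma from_AB_unitary:
  assumes "N \<in> unitary"
  shows "from_AB N \<in> unitary"
proof -
  have "to_AB (from_AB N ** adjoint_mat (from_AB N)) = to_AB (mat 1)"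
    using assms by (simp add: to_AB_mult to_AB_adjoint to_AB_mat unitary_iff)
  then show ?thesis
    unfolding unitary_iff by (metis from_AB_to_AB)
qed

lemma PGL_to_AB_pclass: "PGL_to_AB (pclass A) = pclass (to_AB A)"
  by (simp add: PGL_to_AB_def pclass_eq setcompr_eq_image image_image to_AB_mult to_AB_mat)

lemma PGL_to_AB_inverse: "from_AB ` PGL_to_AB g = g"
  by (simp add: PGL_to_AB_def image_image)

lemma from_AB_pclass: "from_AB ` pclass B = pclass (from_AB B)"
  by (metis PGL_to_AB_inverse PGL_to_AB_pclass to_AB_from_AB)

text \<open>Universal property of the quotient topology: continuity of \<Phi> is tested on unitary
  representatives, where it is continuity of \<open>h\<close>.\<close>

lemma continuous_map_PU:
  fixes h :: "complex^'m^'m \<Rightarrow> complex^'n^'n"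
    and \<Phi> :: "(complex^'m^'m) set \<Rightarrow> (complex^'n^'n) set"
  assumes cont: "continuous_on UNIV h" and uni: "\<And>A. A \<in> unitary \<Longrightarrow> h A \<in> unitary"
    and \<Phi>: "\<And>A. A \<in> unitary \<Longrightarrow> \<Phi> (pclass A) = pclass (h A)"
  shows "continuous_map PU_top PU_top \<Phi>"
  unfolding continuous_map_def
proof (intro conjI allI impI)
  show "\<Phi> \<in> topspace PU_top \<rightarrow> topspace PU_top"
    using uni by (auto simp: topspace_PU_top carrier_PU \<Phi>)
  fix V :: "(complex^'n^'n) set set"
  assume V: "openin PU_top V"
  then obtain W where W: "open W" "{A \<in> unitary. pclass A \<in> V} = unitary \<inter> W"
    by (auto simp: openin_PU_top_iff openin_open)
  have "{A \<in> unitary. pclass A \<in> {x \<in> topspace PU_top. \<Phi> x \<in> V}} = unitary \<inter> h -` W" (is "?L = ?R")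
  proof (intro equalityI subsetI)
    fix A assume "A \<in> ?L"
    then have "A \<in> unitary" "h A \<in> {A \<in> unitary. pclass A \<in> V}"
      using uni by (auto simp: \<Phi>)
    then show "A \<in> ?R"
      unfolding W(2) by auto
  next
    fix A assume "A \<in> ?R"
    then have "A \<in> unitary" "h A \<in> unitary \<inter> W"
      using uni by auto
    then show "A \<in> ?L"
      unfolding W(2)[symmetric] by (auto simp: \<Phi> topspace_PU_top carrier_PU)
  qed
  moreover have "open (h -` W)"
    using cont W(1) by (simp add: open_vimage)
  ultimately show "openin PU_top {x \<in> topspace PU_top. \<Phi> x \<in> V}"
    by (auto simp: openin_PU_top_iff topspace_PU_top openin_open)
qed

lemma homeomorphic_map_PGL_to_AB: "homeomorphic_map PU_top PU_top PGL_to_AB"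
proof -
  have "continuous_on UNIV to_AB" "continuous_on UNIV from_AB"
    unfolding to_AB_def from_AB_def by (intro continuous_intros)+
  then have "continuous_map PU_top PU_top PGL_to_AB" "continuous_map PU_top PU_top ((`) from_AB)"
    using continuous_map_PU[where h = to_AB and \<Phi> = PGL_to_AB, OF _ to_AB_unitary PGL_to_AB_pclass] 
      continuous_map_PU[where h = from_AB and \<Phi> = "(`) from_AB", OF _ from_AB_unitary from_AB_pclass]
    by blast+
  moreover have "PGL_to_AB (from_AB ` y) = y" for y
    by (simp add: PGL_to_AB_def image_image)
  ultimately have "homeomorphic_maps PU_top PU_top PGL_to_AB ((`) from_AB)"
    by (simp add: homeomorphic_maps_def PGL_to_AB_inverse)
  then show ?thesis
    by (rule homeomorphic_maps_imp_map)
qed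

lemma iso_PGL_to_AB: "PGL_to_AB \<in> iso PU PU"
proof -
  have "PGL_to_AB (from_AB ` y) = y" for y
    by (simp add: PGL_to_AB_def image_image)
  then have "bij_betw PGL_to_AB (carrier PU) (carrier PU)"
    by (intro bij_betw_byWitness[where f' = "(`) from_AB"])
      (auto simp: PGL_to_AB_inverse carrier_PU PGL_to_AB_pclass from_AB_pclass to_AB_unitary from_AB_unitary)
  moreover have "PGL_to_AB \<in> hom PU PU"
    by (rule homI) (auto simp: carrier_PU PGL_to_AB_pclass to_AB_unitary PU_mult to_AB_mult)
  ultimately show ?thesis
    by (simp add: iso_def)
qed

section \<open>Analytic continuation of a fourth root\<close>

text \<open>Distinct fourth roots of one number have distance \<open>2 * cmod b\<close> or
  \<open>sqrt 2 * cmod b\<close>. Thus two nearby branches coincide pointwise, with no appeal to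
  connected domains.\<close>

lemma fourth_roots_separated:
  fixes a b :: complex
  assumes "a ^ 4 = b ^ 4" "cmod (a - b) < cmod b"
  shows "a = b"
proof (rule ccontr)
  assume "a \<noteq> b"
  have "(a - b) * (a + b) * (a - \<i> * b) * (a + \<i> * b) = a ^ 4 - b ^ 4"
    by (simp add: algebra_simps power4_eq_xxxx)
  then have "(a - b) * (a + b) * (a - \<i> * b) * (a + \<i> * b) = 0"
    using assms(1) by simp
  with \<open>a \<noteq> b\<close> consider "a = - b" | "a = \<i> * b" | "a = - (\<i> * b)"
    by (auto simp: add_eq_0_iff2)
  then have "a - b = -2 * b \<or> a - b = (\<i> - 1) * b \<or> a - b = (- \<i> - 1) * b"
    by cases (auto simp: algebra_simps)
  then have "cmod (a - b) = 2 * cmod b \<or> cmod (a - b) = sqrt 2 * cmod b"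
  proof (elim disjE)
    have "cmod (\<i> - 1) = sqrt 2" "cmod (- \<i> - 1) = sqrt 2"
      by (simp_all add: cmod_def)
    then show "a - b = (\<i> - 1) * b \<Longrightarrow> ?thesis" "a - b = (- \<i> - 1) * b \<Longrightarrow> ?thesis"
      by (metis norm_mult)+
    show "a - b = -2 * b \<Longrightarrow> ?thesis"
      by (metis norm_mult norm_neg_numeral)
  qed
  moreover have "1 * cmod b \<le> sqrt 2 * cmod b"
    by (intro mult_right_mono) simp_all
  ultimately have "cmod b \<le> cmod (a - b)"
    by auto
  with assms(2) show False
    by simp
qed

section \<open>Holomorphic functions of two variables\<close>

lemma holomorphic2_on_const_mult:
  assumes "holomorphic2_on f D"
  shows "holomorphic2_on (\<lambda>p. c * f p) D"
  unfolding holomorphic2_on_def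
proof
  fix p assume "p \<in> D"
  then obtain a b where "(f has_derivative (\<lambda>h. a * fst h + b * snd h)) (at p)"
    using assms by (auto simp: holomorphic2_on_def)
  then have "((\<lambda>p. c * f p) has_derivative (\<lambda>h. c * (a * fst h + b * snd h))) (at p)"
    by (rule has_derivative_mult_right)
  then show "\<exists>a b. ((\<lambda>p. c * f p) has_derivative (\<lambda>h. a * fst h + b * snd h)) (at p)"
    by (intro exI[of _ "c * a"] exI[of _ "c * b"]) (simp add: algebra_simps)
qed

lemma holomorphic2_on_rotate:
  assumes "holomorphic2_on f D"
  shows "holomorphic2_on (\<lambda>p. f (c * fst p, d * snd p)) {p. (c * fst p, d * snd p) \<in> D}"
  unfolding holomorphic2_on_def
proof
  fix p assume "p \<in> {p. (c * fst p, d * snd p) \<in> D}"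
  then obtain a b where f: "(f has_derivative (\<lambda>h. a * fst h + b * snd h)) (at (c * fst p, d * snd p))"
    using assms by (auto simp: holomorphic2_on_def)
  have "((\<lambda>p. (c * fst p, d * snd p)) has_derivative (\<lambda>h. (c * fst h, d * snd h))) (at p)"
    by (auto intro!: derivative_eq_intros)
  from has_derivative_compose[OF this f]
  show "\<exists>a b. ((\<lambda>p. f (c * fst p, d * snd p)) has_derivative (\<lambda>h. a * fst h + b * snd h)) (at p)"
    by (intro exI[of _ "a * c"] exI[of _ "b * d"]) (simp add: algebra_simps)
qed

lemma holomorphic2_on_isCont:
  assumes "holomorphic2_on f D" "p \<in> D"
  shows "isCont f p"
  using assms has_derivative_continuous by (fastforce simp: holomorphic2_on_def)

lemma holomorphic2_on_line:
  assumes "holomorphic2_on f D"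
  shows "(\<lambda>z. f (p + (z * a, z * b))) holomorphic_on {z. p + (z * a, z * b) \<in> D}"
proof (rule holomorphic_onI)
  fix z assume "z \<in> {z. p + (z * a, z * b) \<in> D}"
  then obtain c d where f: "(f has_derivative (\<lambda>h. c * fst h + d * snd h)) (at (p + (z * a, z * b)))"
    using assms by (auto simp: holomorphic2_on_def)
  have "((\<lambda>z. p + (z * a, z * b)) has_derivative (\<lambda>h. (h * a, h * b))) (at z)"
    by (auto intro!: derivative_eq_intros)
  from has_derivative_compose[OF this f]
  have "((\<lambda>z. f (p + (z * a, z * b))) has_field_derivative (c * a + d * b)) (at z)"
    unfolding has_field_derivative_def
    by (rule has_derivative_eq_rhs) (auto simp: fun_eq_iff algebra_simps)
  then show "(\<lambda>z. f (p + (z * a, z * b))) field_differentiable (at z within {z. p + (z * a, z * b) \<in> D})"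
    using field_differentiable_at_within field_differentiable_def by blast
qed

text \<open>By restriction to the complex line through \<open>p\<close> and \<open>q\<close>.\<close>

lemma holomorphic2_on_ball_eq:
  assumes hol: "holomorphic2_on f (ball x r)" "holomorphic2_on g (ball x r)"
    and p: "p \<in> ball x r" "\<forall>\<^sub>F q in nhds p. f q = g q" and q: "q \<in> ball x r"
  shows "f q = g q"
proof -
  define a b where "a = fst (q - p)" and "b = snd (q - p)"
  define l where "l = (\<lambda>z. p + (z * a, z * b))"
  define T where "T = {z. l z \<in> ball x r}"
  have l0: "l 0 = p" and l1: "l 1 = q"
    by (auto simp: l_def a_def b_def prod_eq_iff)
  have cont: "continuous_on UNIV l"
    unfolding l_def by (intro continuous_intros)
  have "T = l -` ball x r"
    by (auto simp: T_def)
  then have "open T"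
    using cont by (simp add: open_vimage)
  \<comment> \<open>As the preimage of a ball under an affine map; it supplies the connectedness
    needed by the identity theorem in one variable.\<close>
  have "convex T"
  proof (rule convexI)
    fix y z :: complex and s t :: real
    assume "y \<in> T" "z \<in> T" and st: "0 \<le> s" "0 \<le> t" "s + t = 1"
    have "p = s *\<^sub>R p + t *\<^sub>R p"
      using st by (simp flip: scaleR_add_left)
    then have "l (s *\<^sub>R y + t *\<^sub>R z) = s *\<^sub>R l y + t *\<^sub>R l z"
      by (simp add: l_def prod_eq_iff algebra_simps)
    also have "\<dots> \<in> ball x r"
      using \<open>y \<in> T\<close> \<open>z \<in> T\<close> st by (intro convexD[OF convex_ball]) (auto simp: T_def)
    finally show "s *\<^sub>R y + t *\<^sub>R z \<in> T"
      by (simp add: T_def)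
  qed
  obtain W where W: "open W" "p \<in> W" "\<And>q. q \<in> W \<Longrightarrow> f q = g q"
    using p(2) by (auto simp: eventually_nhds)
  have "f (l 1) = g (l 1)"
  proof (rule analytic_continuation_open[where s = "l -` W \<inter> T" and s' = T and z = 1
          and f = "\<lambda>z. f (l z)" and g = "\<lambda>z. g (l z)"])
    show "open (l -` W \<inter> T)"
      using W(1) cont \<open>open T\<close> by (auto intro!: open_Int open_vimage)
    show "l -` W \<inter> T \<noteq> {}"
      using W(2) p(1) l0 by (auto simp: T_def intro!: exI[of _ 0])
    show "(\<lambda>z. f (l z)) holomorphic_on T" "(\<lambda>z. g (l z)) holomorphic_on T"
      using holomorphic2_on_line[OF hol(1)] holomorphic2_on_line[OF hol(2)] by (simp_all add: T_def l_def)
    show "1 \<in> T"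
      using l1 q by (simp add: T_def)
  qed (use W(3) \<open>open T\<close> \<open>convex T\<close> in \<open>auto intro: convex_connected\<close>)
  then show ?thesis
    by (simp add: l1)
qed


lemma holomorphic2_on_power:
  assumes "holomorphic2_on f D"
  shows "holomorphic2_on (\<lambda>p. f p ^ n) D"
  unfolding holomorphic2_on_def
proof
  fix p assume "p \<in> D"
  then obtain a b where "(f has_derivative (\<lambda>h. a * fst h + b * snd h)) (at p)"
    using assms by (auto simp: holomorphic2_on_def)
  then have "((\<lambda>p. f p ^ n) has_derivative
      (\<lambda>h. (of_nat n * f p ^ (n - 1) * a) * fst h + (of_nat n * f p ^ (n - 1) * b) * snd h)) (at p)"
    by (auto intro!: derivative_eq_intros simp: algebra_simps)
  then show "\<exists>a b. ((\<lambda>p. f p ^ n) has_derivative (\<lambda>h. a * fst h + b * snd h)) (at p)"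
    by blast
qed

lemma holomorphic2_on_subset: "holomorphic2_on f D \<Longrightarrow> E \<subseteq> D \<Longrightarrow> holomorphic2_on f E"
  by (auto simp: holomorphic2_on_def)

lemma holomorphic2_on_fst: "holomorphic2_on fst D"
  unfolding holomorphic2_on_def
  by (intro ballI exI[of _ 1] exI[of _ 0]) (auto intro!: derivative_eq_intros)

lemma holomorphic2_on_snd: "holomorphic2_on snd D"
  unfolding holomorphic2_on_def
  by (intro ballI exI[of _ 1] exI[of _ 0]) (auto intro!: derivative_eq_intros)

text \<open>Angles are measured in full turns, so that a loop over the unit interval is
  \<open>turn t\<close> and a fourth root follows it by \<open>turn (t / 4)\<close>.\<close>

definition turn :: "real \<Rightarrow> complex" where
  "turn x = exp (2 * of_real pi * \<i> * of_real x)"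

lemma turn_add: "turn (x + y) = turn x * turn y"
  by (simp add: turn_def exp_add[symmetric] algebra_simps)

lemma turn_minus_mult [simp]: "turn (- x) * turn x = 1" "turn x * turn (- x) = 1"
  using turn_add[of x "- x"] turn_add[of "- x" x] by (simp_all add: turn_def)

lemma turn_0 [simp]: "turn 0 = 1"
  by (simp add: turn_def)

lemma turn_1 [simp]: "turn 1 = 1" "turn (- 1) = 1"
  using exp_two_pi_i turn_minus_mult[of 1] by (simp_all add: turn_def mult_ac)

lemma turn_quarter: "turn (1 / 4) = \<i>"
proof -
  have "turn (1 / 4) = exp (\<i> * of_real (pi / 2))"
    by (simp add: turn_def field_simps)
  then show ?thesis
    by (simp add: exp_Euler sin_of_real cos_of_real flip: of_real_divide)
qed

lemma turn_nonzero [simp]: "turn x \<noteq> 0"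
  by (simp add: turn_def)

lemma turn_power: "turn x ^ n = turn (of_nat n * x)"
  by (simp add: turn_def exp_of_nat_mult[symmetric] algebra_simps)

lemma continuous_on_turn [continuous_intros]:
  "continuous_on S f \<Longrightarrow> continuous_on S (\<lambda>x. turn (f x))"
  unfolding turn_def by (intro continuous_intros)

text \<open>\<open>k\<close> counts the turns of \<open>L\<close> along the path. The identity
  theorem makes the equation for the fourth power locally constant in the parameter, so it holds
  along the whole path; continuity then leaves no choice among the four roots.\<close>

lemma continues_along_root:
  assumes cont: "continues_along \<gamma> f g" and path: "continuous_on {0..1} \<gamma>"
    and L: "holomorphic2_on L UNIV" "\<And>t. t \<in> {0..1} \<Longrightarrow> L (\<gamma> t) = turn (k * t) * L (\<gamma> 0)"
    and root: "\<forall>\<^sub>F p in nhds (\<gamma> 0). f p ^ 4 = L p"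
  shows "g (\<gamma> 1) = turn (k / 4) * f (\<gamma> 0)"
proof -
  obtain F D where
    D: "\<And>t. t \<in> {0..1} \<Longrightarrow> open (D t) \<and> \<gamma> t \<in> D t \<and> holomorphic2_on (F t) (D t)" and
    near: "\<And>t. t \<in> {0..1} \<Longrightarrow> \<forall>\<^sub>F s in at t within {0..1}.
           \<gamma> s \<in> D t \<and> (\<forall>\<^sub>F p in nhds (\<gamma> s). F s p = F t p)" and
    F0: "\<forall>\<^sub>F p in nhds (\<gamma> 0). F 0 p = f p" and F1: "\<forall>\<^sub>F p in nhds (\<gamma> 1). F 1 p = g p"
    using cont unfolding continues_along_def by blast
  define P where "P t \<longleftrightarrow> (\<forall>\<^sub>F p in nhds (\<gamma> t). F t p ^ 4 = L p)" for t
  have P: "P t" if "t \<in> {0..1}" for t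
  proof (rule connected_induction_simple[where S = "{0..1}" and P = P and a = 0 and b = t])
    show "P 0"
      unfolding P_def using root F0 by eventually_elim simp
    fix t :: real assume t: "t \<in> {0..1}"
    \<comment> \<open>\<open>D t\<close> may be disconnected; the identity theorem is applied on a
      ball around \<open>\<gamma> t\<close> inside it.\<close>
    obtain r where r: "r > 0" "ball (\<gamma> t) r \<subseteq> D t"
      using D[OF t] open_contains_ball by blast
    have "(\<gamma> \<longlongrightarrow> \<gamma> t) (at t within {0..1})"
      using path t by (simp add: continuous_on_def)
    then have "\<forall>\<^sub>F s in at t within {0..1}. \<gamma> s \<in> ball (\<gamma> t) r"
      using r(1) by (auto dest!: tendstoD[where e = r] simp: dist_commute)
    with near[OF t] have "\<forall>\<^sub>F s in at t within {0..1}.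
        \<gamma> s \<in> ball (\<gamma> t) r \<and> (\<forall>\<^sub>F p in nhds (\<gamma> s). F s p = F t p)"
      by eventually_elim blast
    then obtain T where T: "open T" "t \<in> T" and T_near: "\<And>s. s \<in> T \<Longrightarrow> s \<in> {0..1} \<Longrightarrow> s \<noteq> t \<Longrightarrow>
        \<gamma> s \<in> ball (\<gamma> t) r \<and> (\<forall>\<^sub>F p in nhds (\<gamma> s). F s p = F t p)"
      unfolding eventually_at_topological by blast
    \<comment> \<open>The filter \<open>at t within\<close> leaves out \<open>t\<close> itself,
      where both claims are trivial.\<close>
    have T_near': "\<gamma> s \<in> ball (\<gamma> t) r \<and> (\<forall>\<^sub>F p in nhds (\<gamma> s). F s p = F t p)"
      if "s \<in> T" "s \<in> {0..1}" for s
      using T_near[OF that] r(1) by (cases "s = t") auto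
    show "\<exists>T. openin (top_of_set {0..1}) T \<and> t \<in> T \<and> (\<forall>x\<in>T. \<forall>y\<in>T. P x \<longrightarrow> P y)"
    proof (intro exI[of _ "{0..1} \<inter> T"] conjI ballI impI)
      fix x y assume x: "x \<in> {0..1} \<inter> T" and y: "y \<in> {0..1} \<inter> T" and "P x"
      have "\<forall>\<^sub>F p in nhds (\<gamma> x). F x p = F t p"
        using T_near' x by blast
      with \<open>P x\<close>[unfolded P_def] have "\<forall>\<^sub>F p in nhds (\<gamma> x). F t p ^ 4 = L p"
        by eventually_elim simp
      then have eq: "F t q ^ 4 = L q" if "q \<in> ball (\<gamma> t) r" for q
        using holomorphic2_on_ball_eq[of "\<lambda>p. F t p ^ 4" "\<gamma> t" r L "\<gamma> x" q] that T_near' x r(2) D[OF t] L(1)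
        by (blast intro: holomorphic2_on_power holomorphic2_on_subset)
      have "\<forall>\<^sub>F q in nhds (\<gamma> y). q \<in> ball (\<gamma> t) r"
        using T_near' y by (intro eventually_nhds_in_open) auto
      moreover have "\<forall>\<^sub>F q in nhds (\<gamma> y). F y q = F t q"
        using T_near' y by blast
      ultimately show "P y"
        unfolding P_def by eventually_elim (simp add: eq)
    qed (use T t in \<open>auto simp: openin_open_Int\<close>)
  qed (use that in auto)
  \<comment> \<open>The factor undoes the expected rotation, so every \<open>w t\<close> is a fourth
    root of the one number \<open>L (\<gamma> 0)\<close>; a continuous function with finite range on
    an interval is constant.\<close>
  define w where "w t = turn (- (k * t / 4)) * F t (\<gamma> t)" for t
  have "continuous_on {0..1} (\<lambda>t. F t (\<gamma> t))"
    unfolding continuous_on_def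
  proof
    fix t :: real assume t: "t \<in> {0..1}"
    have "isCont (F t) (\<gamma> t)"
      using D[OF t] holomorphic2_on_isCont by blast
    moreover have "(\<gamma> \<longlongrightarrow> \<gamma> t) (at t within {0..1})"
      using path t by (simp add: continuous_on_def)
    ultimately have "((\<lambda>s. F t (\<gamma> s)) \<longlongrightarrow> F t (\<gamma> t)) (at t within {0..1})"
      by (rule isCont_tendsto_compose)
    moreover have "\<forall>\<^sub>F s in at t within {0..1}. F t (\<gamma> s) = F s (\<gamma> s)"
      using near[OF t] by eventually_elim (auto dest: eventually_nhds_x_imp_x)
    ultimately show "((\<lambda>s. F s (\<gamma> s)) \<longlongrightarrow> F t (\<gamma> t)) (at t within {0..1})"
      by (rule Lim_transform_eventually)
  qed
  then have "continuous_on {0..1} w"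
    unfolding w_def by (intro continuous_intros) auto
  moreover have "w t ^ 4 = L (\<gamma> 0)" if "t \<in> {0..1}" for t
  proof -
    have "F t (\<gamma> t) ^ 4 = L (\<gamma> t)"
      using P[OF that] unfolding P_def by (rule eventually_nhds_x_imp_x)
    then have "w t ^ 4 = (turn (- (k * t)) * turn (k * t)) * L (\<gamma> 0)"
      using L(2)[OF that] by (simp add: w_def power_mult_distrib turn_power)
    then show ?thesis
      by simp
  qed
  then have "finite (w ` {0..1})"
    by (intro finite_subset[OF _ finite_nth_roots[of 4 "L (\<gamma> 0)"]]) auto
  ultimately have "w constant_on {0..1}"
    by (intro continuous_finite_range_constant) auto
  then have "w 1 = w 0"
    by (auto simp: constant_on_def)
  moreover have "F 0 (\<gamma> 0) = f (\<gamma> 0)" "F 1 (\<gamma> 1) = g (\<gamma> 1)"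
    using F0 F1 by (auto dest: eventually_nhds_x_imp_x)
  ultimately have "turn (- (k / 4)) * g (\<gamma> 1) = f (\<gamma> 0)"
    by (simp add: w_def)
  then have "turn (k / 4) * f (\<gamma> 0) = (turn (k / 4) * turn (- (k / 4))) * g (\<gamma> 1)"
    by (metis mult.assoc)
  then show ?thesis
    by simp
qed

text \<open>
  Precomposing \<open>f\<close> with the inverse rotation and correcting by the phase \<open>turn (k * t / 4)\<close> yields the
  function elements; no branch of the logarithm is needed.
\<close>

lemma continues_along_rotation:
  assumes U: "open U" "(u0, v0) \<in> U" and f: "holomorphic2_on f U" "\<And>p. p \<in> U \<Longrightarrow> f p ^ 4 = L p"
    and L: "L (u0, v0) \<noteq> 0"
      "\<And>t p. L (turn (a * t) * fst p, turn (b * t) * snd p) = turn (k * t) * L p"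
  shows "\<exists>g. continues_along (\<lambda>t. (u0 * turn (a * t), v0 * turn (b * t))) f g"
proof -
  define \<gamma> where "\<gamma> = (\<lambda>t. (u0 * turn (a * t), v0 * turn (b * t)))"
  define R where "R t p = (turn (- (a * t)) * fst p, turn (- (b * t)) * snd p)" for t p
  define F where "F t p = turn (k * t / 4) * f (R t p)" for t p
  define D where "D t = {p. R t p \<in> U}" for t
  have R_\<gamma>: "R t (\<gamma> t) = (u0, v0)" for t
    by (simp add: R_def \<gamma>_def mult_ac)
  have root: "F t p ^ 4 = L p" if "R t p \<in> U" for t p
  proof -
    have "L (R t p) = turn (- (k * t)) * L p"
      using L(2)[of "- t" p] by (simp add: R_def)
    then have "F t p ^ 4 = (turn (k * t) * turn (- (k * t))) * L p"
      using f(2)[OF that] by (simp add: F_def power_mult_distrib turn_power)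
    then show ?thesis
      by simp
  qed
  have cont_\<gamma>: "continuous_on S \<gamma>" for S
    unfolding \<gamma>_def by (intro continuous_intros)
  have open_D: "open (D t)" for t
  proof -
    have "D t = R t -` U"
      by (auto simp: D_def)
    moreover have "continuous_on UNIV (R t)"
      unfolding R_def by (intro continuous_intros)
    ultimately show ?thesis
      using U(1) by (simp add: open_vimage)
  qed
  have hol: "holomorphic2_on (F t) (D t)" for t
    unfolding F_def D_def R_def by (intro holomorphic2_on_const_mult holomorphic2_on_rotate f)
  have nz: "f (u0, v0) \<noteq> 0"
    using f(2)[OF U(2)] L(1) by auto
  have near: "\<forall>\<^sub>F s in at t within {0..1}. \<gamma> s \<in> D t \<and> (\<forall>\<^sub>F p in nhds (\<gamma> s). F s p = F t p)" for t
  proof -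
    define w where "w = F t (\<gamma> t)"
    have w: "w \<noteq> 0"
      using nz by (simp add: w_def F_def R_\<gamma>)
    \<comment> \<open>Instantiating \<open>h\<close> with \<open>fst\<close> and with the constant
      \<open>t\<close> treats \<open>F s\<close> and \<open>F t\<close> by the same
      estimate.\<close>
    have cont_R: "isCont (\<lambda>x. R (h x) (snd x)) (t, \<gamma> t)"
      if "continuous_on UNIV h" for h :: "real \<times> complex \<times> complex \<Rightarrow> real"
    proof -
      have "continuous_on UNIV (\<lambda>x. R (h x) (snd x))"
        unfolding R_def by (intro continuous_intros that)
      then show ?thesis
        by (rule continuous_on_interior) simp
    qed
    have isCont_F: "isCont (\<lambda>x. F (h x) (snd x)) (t, \<gamma> t)"
      if "h (t, \<gamma> t) = t" "continuous_on UNIV h" for h :: "real \<times> complex \<times> complex \<Rightarrow> real"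
    proof -
      have tR: "isCont (\<lambda>x. turn (k * h x / 4)) (t, \<gamma> t)"
      proof -
        have "continuous_on UNIV (\<lambda>x. turn (k * h x / 4))"
          by (intro continuous_intros that(2)) simp
        then show ?thesis
          by (rule continuous_on_interior) simp
      qed
      have "isCont f (R (h (t, \<gamma> t)) (snd (t, \<gamma> t)))"
        using f(1) U(2) that(1) by (simp add: R_\<gamma> holomorphic2_on_isCont)
      then have fR: "isCont (\<lambda>x. f (R (h x) (snd x))) (t, \<gamma> t)"
        using isCont_o2[OF cont_R[OF that(2)]] by blast
      show ?thesis
        unfolding F_def by (rule isCont_mult[OF tR fR])
    qed
    \<comment> \<open>Two values within a quarter of \<open>cmod w\<close> from \<open>w\<close>
      differ by less than half of \<open>cmod w\<close>, while each has modulus above three quarters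
      of it; \<open>fourth_roots_separated\<close> then applies.\<close>
    have ev: "\<forall>\<^sub>F x in nhds (t, \<gamma> t). dist (F (h x) (snd x)) w < cmod w / 4 \<and> R (h x) (snd x) \<in> U"
      if h: "h (t, \<gamma> t) = t" "continuous_on UNIV h" for h :: "real \<times> complex \<times> complex \<Rightarrow> real"
    proof (rule eventually_conj)
      have "((\<lambda>x. F (h x) (snd x)) \<longlongrightarrow> w) (nhds (t, \<gamma> t))"
        using isCont_F[OF h] h(1) by (simp add: w_def isCont_def tendsto_nhds_iff)
      then show "\<forall>\<^sub>F x in nhds (t, \<gamma> t). dist (F (h x) (snd x)) w < cmod w / 4"
        using w by (intro tendstoD) auto
      have "((\<lambda>x. R (h x) (snd x)) \<longlongrightarrow> (u0, v0)) (nhds (t, \<gamma> t))"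
        using cont_R[OF h(2)] h(1) R_\<gamma>[of t] by (simp add: isCont_def tendsto_nhds_iff)
      then show "\<forall>\<^sub>F x in nhds (t, \<gamma> t). R (h x) (snd x) \<in> U"
        using U by (rule topological_tendstoD)
    qed
    have "\<forall>\<^sub>F x in nhds (t, \<gamma> t).
        (dist (F (fst x) (snd x)) w < cmod w / 4 \<and> R (fst x) (snd x) \<in> U) \<and>
        (dist (F t (snd x)) w < cmod w / 4 \<and> R t (snd x) \<in> U)"
      using eventually_conj[OF ev[of fst] ev[of "\<lambda>_. t"]] by (simp add: continuous_on_fst)
    \<comment> \<open>A neighbourhood of product form is needed, since \<open>F s\<close> and
      \<open>F t\<close> have to agree on a full neighbourhood of \<open>\<gamma> s\<close> and not
      just at that point.\<close>
    then obtain P Q where PQ: "eventually P (nhds t)" "eventually Q (nhds (\<gamma> t))"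
      and PQ_ball: "\<And>s p. P s \<Longrightarrow> Q p \<Longrightarrow>
        (dist (F s p) w < cmod w / 4 \<and> R s p \<in> U) \<and> (dist (F t p) w < cmod w / 4 \<and> R t p \<in> U)"
      unfolding nhds_prod eventually_prod_filter fst_conv snd_conv by blast
    obtain A where A: "open A" "t \<in> A" "\<And>s. s \<in> A \<Longrightarrow> P s"
      using PQ(1) unfolding eventually_nhds by blast
    obtain B where B: "open B" "\<gamma> t \<in> B" "\<And>p. p \<in> B \<Longrightarrow> Q p"
      using PQ(2) unfolding eventually_nhds by blast
    note AB = A(1) B(1) A(2) B(2) and ball = PQ_ball[OF A(3) B(3)]
    have eq: "F s p = F t p" if "s \<in> A" "p \<in> B" for s p
    proof (rule fourth_roots_separated)
      show "F s p ^ 4 = F t p ^ 4"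
        using ball[OF that] by (simp add: root)
      have "dist (F s p) (F t p) < cmod w / 4 + cmod w / 4"
        using ball[OF that] by (intro dist_triangle_less_add[where y = w]) auto
      moreover have "cmod w \<le> cmod (F t p) + dist (F t p) w"
        by (metis dist_norm norm_minus_commute norm_triangle_sub)
      moreover have "dist (F t p) w < cmod w / 4"
        using ball[OF that] by blast
      ultimately have "dist (F s p) (F t p) < cmod (F t p)"
        using zero_less_norm_iff[of w] w by linarith
      then show "cmod (F s p - F t p) < cmod (F t p)"
        by (simp add: dist_norm)
    qed
    have "(\<gamma> \<longlongrightarrow> \<gamma> t) (at t within {0..1})"
      using cont_\<gamma>[of "insert t {0..1}"] by (auto simp: continuous_on_def intro: tendsto_within_subset)
    then have "\<forall>\<^sub>F s in at t within {0..1}. \<gamma> s \<in> B"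
      using AB by (intro topological_tendstoD)
    moreover have "\<forall>\<^sub>F s in at t within {0..1}. s \<in> A"
      using AB by (auto simp: eventually_at_topological)
    ultimately show ?thesis
    proof eventually_elim
      case (elim s)
      have "\<forall>\<^sub>F p in nhds (\<gamma> s). p \<in> B"
        using AB elim by (intro eventually_nhds_in_open)
      then have "\<forall>\<^sub>F p in nhds (\<gamma> s). F s p = F t p"
        by eventually_elim (use eq elim in blast)
      then show ?case
        using ball elim by (auto simp: D_def)
    qed
  qed
  have "continues_along \<gamma> f (F 1)"
    unfolding continues_along_def
  proof (intro exI[of _ F] exI[of _ D] conjI ballI)
    show "\<forall>\<^sub>F p in nhds (\<gamma> 0). F 0 p = f p"
      by (simp add: F_def R_def)
  qed (use open_D hol near R_\<gamma> U in \<open>auto simp: D_def\<close>)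
  then show ?thesis
    unfolding \<gamma>_def by blast
qed

section \<open>Monodromy of the Weyl representation\<close>

lemma sum_Z4: "(\<Sum>i\<in>(UNIV :: 4 set). f i) = f 0 + f 1 + f 2 + f 3"
proof -
  have four: "(4 :: 4) = 0"
    by simp
  show ?thesis
    unfolding sum_4 four by (simp add: ac_simps)
qed

lemma zeta_eq [simp]: "zeta = \<i>"
  using turn_quarter by (simp add: zeta_def turn_def)

lemma Weyl_X_nth: "Weyl_X $ i $ j = (if i = j + 1 then 1 else 0)"
  by (simp add: Weyl_X_def op_on_kets_def ket_def axis_def)

lemma Weyl_Z_nth: "Weyl_Z $ i $ j = (if i = j then \<i> powi Rep_bit0 j else 0)"
  by (simp add: Weyl_Z_def op_on_kets_def ket_def axis_def)

lemma i_powi_Rep [simp]: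
  "\<i> powi Rep_bit0 (0::4) = 1" "\<i> powi Rep_bit0 (1::4) = \<i>"
  "\<i> powi Rep_bit0 (2::4) = - 1" "\<i> powi Rep_bit0 (3::4) = - \<i>"
  by (simp_all add: bit0.Rep_0 bit0.Rep_1 bit0.Rep_numeral power3_eq_cube)

lemma Weyl_X_unitary: "Weyl_X \<in> unitary"
  by (simp add: unitary_iff vec_eq_iff all_4 Weyl_X_nth adjoint_mat_def matrix_matrix_mult_def sum_Z4 mat_nth)

lemma Weyl_Z_unitary: "Weyl_Z \<in> unitary"
  by (simp add: unitary_iff vec_eq_iff all_4 Weyl_Z_nth adjoint_mat_def matrix_matrix_mult_def sum_Z4 mat_nth)

lemma Weyl_commutation: "Weyl_Z ** Weyl_X = mat \<i> ** (Weyl_X ** Weyl_Z)"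
  unfolding vec_eq_iff all_4 mat_mult_nth
  by (simp add: Weyl_X_nth Weyl_Z_nth matrix_matrix_mult_def sum_Z4)

lemma matrix_inv_unitary: "A \<in> unitary \<Longrightarrow> matrix_inv A = adjoint_mat A"
  by (intro matrix_inv_unique) (simp add: unitary_iff)

text \<open>The eigenvalues of \<open>Weyl_Z\<close> are distinct, which makes \<open>N\<close>
  diagonal; the cyclic shift \<open>Weyl_X\<close> then identifies all diagonal entries.\<close>

lemma Weyl_commutant_scalar:
  assumes X: "N ** Weyl_X = Weyl_X ** N" and Z: "N ** Weyl_Z = Weyl_Z ** N"
  shows "\<exists>c. N = mat c"
proof -
  have NZ: "(N ** Weyl_Z) $ i $ j = \<i> powi Rep_bit0 j * N $ i $ j" for i j
    by (simp add: Weyl_Z_nth matrix_matrix_mult_def if_distrib if_distribR mult.commute cong: if_cong)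
  have ZN: "(Weyl_Z ** N) $ i $ j = \<i> powi Rep_bit0 i * N $ i $ j" for i j
    by (simp add: Weyl_Z_nth matrix_matrix_mult_def if_distrib if_distribR cong: if_cong)
  have distinct: "\<forall>i j. i \<noteq> j \<longrightarrow> \<i> powi Rep_bit0 (i::4) \<noteq> \<i> powi Rep_bit0 (j::4)"
    unfolding all_4 by (simp add: complex_eq_iff)
  have diag: "N $ i $ j = 0" if "i \<noteq> j" for i j
    using NZ[of i j] ZN[of i j] Z distinct that by auto
  have NX: "(N ** Weyl_X) $ i $ j = N $ i $ (j + 1)" for i j
    by (simp add: Weyl_X_nth matrix_matrix_mult_def if_distrib if_distribR cong: if_cong)
  have "(Weyl_X ** N) $ (j + 1) $ j = N $ j $ j" for j
    by (simp add: Weyl_X_nth matrix_matrix_mult_def if_distrib if_distribR cong: if_cong)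
  then have "N $ (j + 1) $ (j + 1) = N $ j $ j" for j
    using NX[of "j + 1" j] X by simp
  from this[of 0] this[of 1] this[of 2] have "N $ i $ i = N $ 0 $ 0" for i
    using all_4[of "\<lambda>i. N $ i $ i = N $ 0 $ 0"] by simp
  then show ?thesis
    by (intro exI[of _ "N $ 0 $ 0"]) (auto simp: vec_eq_iff mat_nth diag)
qed

text \<open>Clears the inverse and the value \<open>r\<close> of the branch: the monodromy condition
  becomes a commutation relation independent of the base point.\<close>

lemma conj_scaled_iff:
  fixes A X :: "complex^'n^'n"
  assumes "invertible A" "r \<noteq> 0"
  shows "A ** (mat r ** X) ** matrix_inv A = mat (c * r) ** X \<longleftrightarrow> A ** X = mat c ** (X ** A)"
proof -
  obtain B where B: "A ** B = mat 1" "B ** A = mat 1"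
    using assms(1) unfolding invertible_def by blast
  have "A ** (mat r ** X) ** B = mat (c * r) ** X \<longleftrightarrow> A ** (mat r ** X) = mat (c * r) ** X ** A"
    by (metis B(1,2) matrix_mul_assoc matrix_mul_rid)
  also have "\<dots> \<longleftrightarrow> mat r ** (A ** X) = mat r ** (mat c ** (X ** A))"
  proof -
    have "A ** (mat r ** X) = mat r ** (A ** X)"
      by (rule mult_mat_left_commute)
    moreover have "mat (c * r) ** X ** A = mat r ** (mat c ** (X ** A))"
      by (simp add: matrix_mul_assoc mat_mult_mat mult.commute)
    ultimately show ?thesis
      by simp
  qed
  also have "\<dots> \<longleftrightarrow> A ** X = mat c ** (X ** A)"
    using assms(2) by (simp add: vec_eq_iff)
  finally show ?thesis
    by (simp add: matrix_inv_unique[OF B(1)])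
qed

text \<open>For uniqueness, any solution \<open>A\<close> satisfies the same two commutation
  relations as \<open>M\<close>, so the inverse of \<open>M\<close> times \<open>A\<close> commutes
  with both Weyl operators. All continuations share the end values given by \<open>c\<close> and
  \<open>d\<close>, so the choice among them is immaterial.\<close>

lemma proj_monodromy_eqI:
  assumes nz: "r (\<gamma> 0) \<noteq> 0" "s (\<gamma> 0) \<noteq> 0"
    and r: "\<exists>r'. continues_along \<gamma> r r'" "\<And>r'. continues_along \<gamma> r r' \<Longrightarrow> r' (\<gamma> 1) = c * r (\<gamma> 0)"
    and s: "\<exists>s'. continues_along \<gamma> s s'" "\<And>s'. continues_along \<gamma> s s' \<Longrightarrow> s' (\<gamma> 1) = d * s (\<gamma> 0)"
    and M: "invertible M" "M ** Weyl_X = mat c ** (Weyl_X ** M)" "M ** Weyl_Z = mat d ** (Weyl_Z ** M)"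
  shows "proj_monodromy r s \<gamma> = pclass M"
  unfolding proj_monodromy_def
proof (rule the_equality)
  obtain r' s' where rs: "continues_along \<gamma> r r'" "continues_along \<gamma> s s'"
    using r(1) s(1) by blast
  then have "M ** rep_x r (\<gamma> 0) ** matrix_inv M = rep_x r' (\<gamma> 1)"
    "M ** rep_y s (\<gamma> 0) ** matrix_inv M = rep_y s' (\<gamma> 1)"
    using M nz r(2)[OF rs(1)] s(2)[OF rs(2)] by (simp_all add: rep_x_def rep_y_def conj_scaled_iff)
  with rs M(1) show "\<exists>A r' s'. invertible A \<and> pclass M = pclass A \<and>
        continues_along \<gamma> r r' \<and> continues_along \<gamma> s s' \<and>
        A ** rep_x r (\<gamma> 0) ** matrix_inv A = rep_x r' (\<gamma> 1) \<and>
        A ** rep_y s (\<gamma> 0) ** matrix_inv A = rep_y s' (\<gamma> 1)"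
    by blast
next
  fix g
  assume "\<exists>A r' s'. invertible A \<and> g = pclass A \<and>
        continues_along \<gamma> r r' \<and> continues_along \<gamma> s s' \<and>
        A ** rep_x r (\<gamma> 0) ** matrix_inv A = rep_x r' (\<gamma> 1) \<and>
        A ** rep_y s (\<gamma> 0) ** matrix_inv A = rep_y s' (\<gamma> 1)"
  then obtain A r' s' where A: "invertible A" "g = pclass A"
    and rs: "continues_along \<gamma> r r'" "continues_along \<gamma> s s'"
    and conj: "A ** rep_x r (\<gamma> 0) ** matrix_inv A = rep_x r' (\<gamma> 1)"
        "A ** rep_y s (\<gamma> 0) ** matrix_inv A = rep_y s' (\<gamma> 1)"
    by blast
  have AX: "A ** Weyl_X = mat c ** (Weyl_X ** A)" and AZ: "A ** Weyl_Z = mat d ** (Weyl_Z ** A)"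
    using conj nz A(1) unfolding rep_x_def rep_y_def r(2)[OF rs(1)] s(2)[OF rs(2)]
    by (simp_all add: conj_scaled_iff)
  obtain B where B: "M ** B = mat 1" "B ** M = mat 1"
    using M(1) unfolding invertible_def by blast
  have commute: "(B ** A) ** W = W ** (B ** A)"
    if "A ** W = mat k ** (W ** A)" "M ** W = mat k ** (W ** M)" for k W
  proof -
    have "W ** B = (B ** M) ** W ** B"
      by (simp add: B)
    also have "\<dots> = B ** (mat k ** (W ** M)) ** B"
      unfolding that(2)[symmetric] by (simp add: matrix_mul_assoc)
    also have "\<dots> = mat k ** (B ** W ** (M ** B))"
      unfolding mult_mat_left_commute[of B k] by (simp add: matrix_mul_assoc)
    finally have WB: "W ** B = mat k ** (B ** W)"
      by (simp add: B)
    have "(B ** A) ** W = B ** (mat k ** (W ** A))"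
      unfolding that(1)[symmetric] by (simp add: matrix_mul_assoc)
    also have "\<dots> = (mat k ** (B ** W)) ** A"
      unfolding mult_mat_left_commute[of B k] by (simp add: matrix_mul_assoc)
    also have "\<dots> = W ** (B ** A)"
      unfolding WB[symmetric] by (simp add: matrix_mul_assoc)
    finally show ?thesis .
  qed
  obtain e where "B ** A = mat e"
    using Weyl_commutant_scalar[OF commute[OF AX M(2)] commute[OF AZ M(3)]] by blast
  moreover have "A = M ** (B ** A)"
    by (simp add: B matrix_mul_assoc)
  ultimately have Ae: "A = mat e ** M"
    using mult_mat_commute[of M e] by simp
  have "e \<noteq> 0"
  proof
    assume "e = 0"
    then have "(A ** C) $ 0 $ 0 = 0" for C :: "complex^4^4"
      by (simp add: Ae matrix_mul_assoc[symmetric])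
    then show False
      using A(1) unfolding invertible_def by (metis mat_nth zero_neq_one)
  qed
  then show "g = pclass M"
    by (simp add: A(2) Ae)
qed

text \<open>Treats both roots and both loops at once: in its uses \<open>L\<close> is a coordinate,
  \<open>a\<close> and \<open>b\<close> count the turns of the two coordinates, and \<open>k\<close>
  is the one belonging to \<open>L\<close>.\<close>

lemma root_monodromy:
  assumes U: "open U" "(u0, v0) \<in> U" and f: "holomorphic2_on f U" "\<And>p. p \<in> U \<Longrightarrow> f p ^ 4 = L p"
    and L: "holomorphic2_on L UNIV" "L (u0, v0) \<noteq> 0"
      "\<And>t p. L (turn (a * t) * fst p, turn (b * t) * snd p) = turn (k * t) * L p"
    and \<gamma>: "\<gamma> = (\<lambda>t. (u0 * turn (a * t), v0 * turn (b * t)))"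
  shows "\<exists>g. continues_along \<gamma> f g"
    and "continues_along \<gamma> f g \<Longrightarrow> g (\<gamma> 1) = turn (k / 4) * f (\<gamma> 0)"
    and "f (\<gamma> 0) \<noteq> 0"
proof -
  show "\<exists>g. continues_along \<gamma> f g"
    unfolding \<gamma> using U f L(2,3) by (rule continues_along_rotation)
  have \<gamma>0: "\<gamma> 0 = (u0, v0)"
    by (simp add: \<gamma>)
  show "f (\<gamma> 0) \<noteq> 0"
    using f(2)[OF U(2)] L(2) by (auto simp: \<gamma>0)
  have "\<forall>\<^sub>F p in nhds (\<gamma> 0). p \<in> U"
    unfolding \<gamma>0 using U by (rule eventually_nhds_in_open)
  then have "\<forall>\<^sub>F p in nhds (\<gamma> 0). f p ^ 4 = L p"
    by eventually_elim (rule f(2))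
  moreover have "continuous_on {0..1} \<gamma>"
    unfolding \<gamma> by (intro continuous_intros)
  moreover have "L (\<gamma> t) = turn (k * t) * L (\<gamma> 0)" for t
    using L(3)[of t "(u0, v0)"] by (simp add: \<gamma> mult.commute)
  ultimately show "continues_along \<gamma> f g \<Longrightarrow> g (\<gamma> 1) = turn (k / 4) * f (\<gamma> 0)"
    using continues_along_root L(1) by blast
qed

lemma loop_u_turn: "loop_u u0 v0 = (\<lambda>t. (u0 * turn (1 * t), v0 * turn (0 * t)))"
  and loop_v_turn: "loop_v u0 v0 = (\<lambda>t. (u0 * turn (0 * t), v0 * turn (1 * t)))"
  by (simp_all add: fun_eq_iff loop_u_def loop_v_def turn_def)

lemma monodromy_Weyl:
  assumes U: "open U" "(u0, v0) \<in> U" "U \<subseteq> torus2"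
    and r: "holomorphic2_on r U" "\<And>u v. (u, v) \<in> U \<Longrightarrow> r (u, v) ^ 4 = u"
    and s: "holomorphic2_on s U" "\<And>u v. (u, v) \<in> U \<Longrightarrow> s (u, v) ^ 4 = v"
  shows "proj_monodromy r s (loop_u u0 v0) = pclass Weyl_Z"
    and "proj_monodromy r s (loop_v u0 v0) = pclass (matrix_inv Weyl_X)"
    and "r (u0, v0) \<noteq> 0" "s (u0, v0) \<noteq> 0"
proof -
  have nz: "u0 \<noteq> 0" "v0 \<noteq> 0"
    using U by (auto simp: torus2_def)
  have r': "r p ^ 4 = fst p" and s': "s p ^ 4 = snd p" if "p \<in> U" for p
    using r(2)[of "fst p" "snd p"] s(2)[of "fst p" "snd p"] that by simp_all
  note ru = root_monodromy[OF U(1,2) r(1) r' holomorphic2_on_fst _ _ loop_u_turn, of 1, simplified]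
    and su = root_monodromy[OF U(1,2) s(1) s' holomorphic2_on_snd _ _ loop_u_turn, of 0, simplified]
    and rv = root_monodromy[OF U(1,2) r(1) r' holomorphic2_on_fst _ _ loop_v_turn, of 0, simplified]
    and sv = root_monodromy[OF U(1,2) s(1) s' holomorphic2_on_snd _ _ loop_v_turn, of 1, simplified]
  show "r (u0, v0) \<noteq> 0" "s (u0, v0) \<noteq> 0"
    using ru(3) su(3) nz by (simp_all add: loop_u_turn)
  show "proj_monodromy r s (loop_u u0 v0) = pclass Weyl_Z"
    \<comment> \<open>The loop in \<open>u\<close> multiplies \<open>x\<close> by
      \<open>turn (1 / 4)\<close>, which is \<open>\<i>\<close>, and leaves \<open>y\<close> alone;
      for the loop in \<open>v\<close> the roles are exchanged.\<close>
    by (rule proj_monodromy_eqI[where c = "\<i>" and d = 1])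
      (use ru su nz Weyl_commutation in \<open>simp_all add: turn_quarter unitary_invertible Weyl_Z_unitary\<close>)
  have inv: "matrix_inv Weyl_X = adjoint_mat Weyl_X"
    by (rule matrix_inv_unitary[OF Weyl_X_unitary])
  \<comment> \<open>Multiplying the commutation relation by the inverse of \<open>Weyl_X\<close> on
    both sides shows that conjugation by this inverse scales \<open>Weyl_Z\<close> by
    \<open>\<i>\<close>.\<close>
  have "adjoint_mat Weyl_X ** (Weyl_Z ** Weyl_X) ** adjoint_mat Weyl_X =
      mat \<i> ** (adjoint_mat Weyl_X ** (Weyl_X ** Weyl_Z) ** adjoint_mat Weyl_X)"
    unfolding Weyl_commutation mult_mat_left_commute[of "adjoint_mat Weyl_X" \<i>]
    by (simp add: matrix_mul_assoc)
  then have "adjoint_mat Weyl_X ** Weyl_Z = mat \<i> ** (Weyl_Z ** adjoint_mat Weyl_X)"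
    using unitary_adjoint_cancel[OF Weyl_X_unitary] by (simp add: matrix_mul_assoc)
  moreover have "adjoint_mat Weyl_X ** Weyl_X = Weyl_X ** adjoint_mat Weyl_X"
    using unitary_adjoint_cancel[OF Weyl_X_unitary] by simp
  ultimately show "proj_monodromy r s (loop_v u0 v0) = pclass (matrix_inv Weyl_X)"
    unfolding inv
    by (intro proj_monodromy_eqI[where c = 1 and d = "\<i>"])
      (use rv sv nz in \<open>simp_all add: turn_quarter unitary_invertible unitary_adjoint Weyl_X_unitary\<close>)
qed

text \<open>The exponent splits along the label \<open>a + 2 * b\<close>: the power of
  \<open>\<i>\<close> is \<open>\<i> ^ a * (- 1) ^ b\<close>.\<close>

lemma to_AB_Weyl_Z: "to_AB Weyl_Z = S_gate \<otimes>\<^sub>o Z_gate"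
  by (simp add: vec_eq_iff all_bit Weyl_Z_nth S_gate_def Z_gate_def diag2_mat22 mat22_def)

text \<open>Decrementing \<open>a + 2 * b\<close> modulo 4 flips \<open>a\<close> and borrows from
  \<open>b\<close> exactly when \<open>a\<close> was 0, that is, when the flipped bit is 1. So
  \<open>CNOT\<close> acts after the flip.\<close>

lemma to_AB_Weyl_X_inv: "to_AB (matrix_inv Weyl_X) = CNOT ** (X_gate \<otimes>\<^sub>o mat 1)"
  unfolding matrix_inv_unitary[OF Weyl_X_unitary] CNOT_perm X_A_perm
  by (simp add: vec_eq_iff all_bit adjoint_mat_def Weyl_X_nth perm_mat_def matrix_matrix_mult_def sum_qubits)

section \<open>Entanglement created by the second monodromy gate\<close>

lemma proj_act_pclass: "proj_act (pclass M) (state_class v) = state_class (M *v v)"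
proof -
  have lin: "(mat c ** M) *v (d *s v) = (c * d) *s (M *v v)" for c d :: complex
    by (simp add: vec_eq_iff matrix_vector_mult_def sum_distrib_left mult_ac)
  show ?thesis
    unfolding proj_act_def state_class_def pclass_eq
  proof (intro equalityI subsetI)
    fix x assume "x \<in> {e *s (M *v v) |e. e \<noteq> 0}"
    then obtain e where "e \<noteq> 0" "x = (mat e ** M) *v (1 *s v)"
      unfolding lin by auto
    moreover have "mat e ** M \<in> {mat c ** M |c. c \<noteq> 0}"
      using \<open>e \<noteq> 0\<close> by blast
    moreover have "1 *s v \<in> {c *s v |c. c \<noteq> 0}"
      by (auto intro!: exI[of _ 1])
    ultimately show "x \<in> {A *v w |A w. A \<in> {mat c ** M |c. c \<noteq> 0} \<and> w \<in> {c *s v |c. c \<noteq> 0}}"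
      by blast
  qed (auto simp: lin)
qed

text \<open>The coefficients of a pure tensor form a 2 by 2 matrix of rank one, so its determinant
  vanishes.\<close>

lemma product_state_det:
  assumes "product_state (state_class x)"
  shows "x $ (0, 0) * x $ (1, 1) = x $ (0, 1) * x $ (1, 0)"
proof -
  obtain v w where vw: "state_class x = state_class (v \<otimes>\<^sub>v w)"
    using assms by (auto simp: product_state_def)
  have "x \<in> state_class x"
    unfolding state_class_def by (auto intro!: exI[of _ 1])
  then obtain c where "x = c *s (v \<otimes>\<^sub>v w)"
    unfolding vw by (auto simp: state_class_def)
  then show ?thesis
    by (simp add: tensor_vec_def)
qed

lemma entangling_CNOT_X: "entangling (pclass (CNOT ** (X_gate \<otimes>\<^sub>o mat 1)))"
proof -
  \<comment> \<open>The bit flip fixes \<open>v\<close>, and \<open>CNOT\<close> sends this product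
    state to the unnormalised Bell state with coefficient 1 at \<open>(0, 0)\<close> and
    \<open>(1, 1)\<close>, whose determinant is 1.\<close>
  define v :: "complex^2" where "v = (\<chi> i. 1)"
  define w :: "complex^2" where "w = axis 0 1"
  have "v $ 0 \<noteq> 0" "w $ 0 \<noteq> 0"
    by (simp_all add: v_def w_def axis_def)
  then have "v \<noteq> 0" "w \<noteq> 0"
    by auto
  then have "product_state (state_class (v \<otimes>\<^sub>v w))"
    by (auto simp: product_state_def)
  moreover have "\<not> product_state (proj_act (pclass (CNOT ** (X_gate \<otimes>\<^sub>o mat 1))) (state_class (v \<otimes>\<^sub>v w)))"
    unfolding proj_act_pclass
    by (rule notI, drule product_state_det)
      (simp add: CNOT_perm X_A_perm perm_mat_def matrix_vector_mult_def matrix_matrix_mult_def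
        sum_qubits tensor_vec_def v_def w_def axis_def)
  ultimately show ?thesis
    by (auto simp: entangling_def)
qed

theorem theorem4p10:
  fixes U :: "(complex \<times> complex) set"
    and root_u root_v :: "complex \<times> complex \<Rightarrow> complex"
    and u0 v0 :: complex
    and g_u g_v :: "(complex^4^4) set"
  assumes "open U" and "simply_connected U" and "U \<subseteq> torus2"
    and "holomorphic2_on root_u U" and "\<And>u v. (u, v) \<in> U \<Longrightarrow> root_u (u, v) ^ 4 = u"
    and "holomorphic2_on root_v U" and "\<And>u v. (u, v) \<in> U \<Longrightarrow> root_v (u, v) ^ 4 = v"
    and "(u0, v0) \<in> U"
    and "g_u = proj_monodromy root_u root_v (loop_u u0 v0)"
    and "g_v = proj_monodromy root_u root_v (loop_v u0 v0)"
  shows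
    "\<comment> \<open>(i)\<close>
     (g_u = pclass (rep_y root_v (u0, v0)) \<and> g_u = pclass Weyl_Z \<and>
      is_local (PGL_to_AB g_u) \<and>
      to_AB Weyl_Z \<equiv>\<^sub>p S_gate \<otimes>\<^sub>o Z_gate) \<and>
     \<comment> \<open>(ii)\<close>
     (g_v = pclass (matrix_inv (rep_x root_u (u0, v0))) \<and> g_v = pclass (matrix_inv Weyl_X) \<and>
      entangling (PGL_to_AB g_v) \<and>
      to_AB (matrix_inv Weyl_X) \<equiv>\<^sub>p CNOT ** (X_gate \<otimes>\<^sub>o mat 1) \<and>
      locally_equivalent (PGL_to_AB g_v) (pclass CNOT)) \<and>
     \<comment> \<open>(iii)\<close>
     (\<forall>G_A G_B. universal_single_qubit G_A \<and> universal_single_qubit G_B \<longrightarrow>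
        generates_dense
          ({pclass (A \<otimes>\<^sub>o mat 1) | A. A \<in> G_A} \<union> {pclass (mat 1 \<otimes>\<^sub>o B) | B. B \<in> G_B} \<union>
           {PGL_to_AB g_v})) \<and>
     PGL_to_AB \<in> iso PU PU \<and> homeomorphic_map PU_top PU_top PGL_to_AB"
proof -
  note monodromy = monodromy_Weyl[OF assms(1,8,3,4,5,6,7)]
  have g_u: "g_u = pclass Weyl_Z" and g_v: "g_v = pclass (matrix_inv Weyl_X)"
    using monodromy(1,2) assms(9,10) by simp_all
  have u_AB: "PGL_to_AB g_u = pclass (S_gate \<otimes>\<^sub>o Z_gate)"
    and v_AB: "PGL_to_AB g_v = pclass (CNOT ** (X_gate \<otimes>\<^sub>o mat 1))"
    by (simp_all add: g_u g_v PGL_to_AB_pclass to_AB_Weyl_Z to_AB_Weyl_X_inv)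
  have proj_refl: "M \<equiv>\<^sub>p M" for M :: "complex^'k^'k"
    by (metis pclass_eq_iff)
  have "g_u = pclass (rep_y root_v (u0, v0))"
    using monodromy(4) by (simp add: g_u rep_y_def)
  moreover have "is_local (PGL_to_AB g_u)"
    unfolding is_local_def u_AB S_gate_def Z_gate_def
    by (intro exI[of _ "diag2 1 \<i>"] exI[of _ "diag2 1 (- 1)"]) (simp add: unitary_invertible diag2_unitary)
  moreover have "g_v = pclass (matrix_inv (rep_x root_u (u0, v0)))"
  proof -
    have "rep_x root_u (u0, v0) ** (mat (1 / root_u (u0, v0)) ** matrix_inv Weyl_X) = mat 1"
      using monodromy(3) matrix_inv_unitary[OF Weyl_X_unitary] unitary_adjoint_cancel(1)[OF Weyl_X_unitary]
      by (simp add: rep_x_def mat_mult_mult)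
    then have "matrix_inv (rep_x root_u (u0, v0)) = mat (1 / root_u (u0, v0)) ** matrix_inv Weyl_X"
      by (rule matrix_inv_unique)
    then show ?thesis
      using monodromy(3) by (simp add: g_v)
  qed
  moreover have "locally_equivalent (PGL_to_AB g_v) (pclass CNOT)"
    unfolding locally_equivalent_def
  proof (intro exI conjI)
    show "is_local_unitary (pclass (mat 1 \<otimes>\<^sub>o mat 1))" "is_local_unitary (pclass (X_gate \<otimes>\<^sub>o mat 1))"
      using X_gate_unitary unitary_one unfolding is_local_unitary_def by blast+
    show "PGL_to_AB g_v = pclass (mat 1 \<otimes>\<^sub>o mat 1) \<otimes>\<^bsub>PGL\<^esub> pclass CNOT \<otimes>\<^bsub>PGL\<^esub> pclass (X_gate \<otimes>\<^sub>o mat 1)"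
      by (simp add: v_AB pclass_mult)
  qed
  moreover have "entangling (PGL_to_AB g_v)"
    unfolding v_AB by (rule entangling_CNOT_X)
  moreover have "to_AB Weyl_Z \<equiv>\<^sub>p S_gate \<otimes>\<^sub>o Z_gate"
    "to_AB (matrix_inv Weyl_X) \<equiv>\<^sub>p CNOT ** (X_gate \<otimes>\<^sub>o mat 1)"
    unfolding to_AB_Weyl_Z to_AB_Weyl_X_inv by (rule proj_refl)+
  moreover have "\<forall>G_A G_B. universal_single_qubit G_A \<and> universal_single_qubit G_B \<longrightarrow>
      generates_dense
        ({pclass (A \<otimes>\<^sub>o mat 1) | A. A \<in> G_A} \<union> {pclass (mat 1 \<otimes>\<^sub>o B) | B. B \<in> G_B} \<union>
         {PGL_to_AB g_v})"
    unfolding v_AB using universal_with_CNOT by blast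
  ultimately show ?thesis
    using g_u g_v iso_PGL_to_AB homeomorphic_map_PGL_to_AB by (intro conjI)
qed

end
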